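(* Let $d\geq 2$ be a fixed integer, let $c_0\geq 1$ be a constant, and let $C_1=2^{10d}c_0$ and $C_2=2^{10d}c_0/\epsilon$, where $\epsilon$ is as below. Let $m=m(n)$, $p_1=(\log (mn))^{1/d}/(m^{(d-1)/(2d)}n^{(d-1)/(2d)})$ and $p_2=(\log n)^{1/d}/(m^{1/2}n^{(d-2)/(2d)})$. If $d$ is odd and $p_1 n\geq p_1 m\geq (\log n)^4$, then with probability at least $1-n^{-\Omega(1)}$ the random bipartite graph $G(m,n,C_1p_1)$ satisfies: every two distinct vertices in the same part are connected by at least $2^{10d}c_0\log n$ internally vertex-disjoint paths of length exactly $d+1$, and every two vertices in different parts are connected by at least $2^{10d}c_0\log n$ internally vertex-disjoint paths of length exactly $d$. If $d$ is even and $\epsilon$ is a fixed constant with $0<\epsilon<1$ such that $p_2 n^{1-\epsilon}\geq p_2 m^{1-\epsilon}\geq (\log n)^4$, then with probability at least $1-n^{-\Omega(1)}$ the random bipartite graph $G(m,n,C_2p_2)$ satisfies: every two distinct vertices in the same part are connected by at least $2^{10d}c_0\log n$ internally vertex-disjoint paths of length exactly $d$, and every two vertices in different parts are connected by at least $2^{10d}c_0\log n$ internally vertex-disjoint paths of length exactly $d+1$.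
   Context: $G(m,n,p)$ denotes the random bipartite graph with bipartition $(U,V)$, $|U|=m$, $|V|=n$, in which each edge $uv$ with $u\in U$, $v\in V$ is present independently with probability $p$. $\log$ denotes the logarithm to base $2$; asymptotic notation is as $n\to\infty$. *)

theory Defs
  imports "HOL-Probability.Probability"
begin

text \<open>Vertices of the bipartite graph: Inl i (i < m) form the part U, Inr j (j < n) the part V.
  A graph is given by its edge indicator E on {..<m} \<times> {..<n}.\<close>

type_synonym bvert = "nat + nat"

definition bip_vertices :: "nat \<Rightarrow> nat \<Rightarrow> bvert set" where
  "bip_vertices m n = Inl ` {..<m} \<union> Inr ` {..<n}"

definition bip_adj :: "nat \<Rightarrow> nat \<Rightarrow> (nat \<times> nat \<Rightarrow> bool) \<Rightarrow> bvert \<Rightarrow> bvert \<Rightarrow> bool" where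
  "bip_adj m n E x y =
     (case (x, y) of
        (Inl i, Inr j) \<Rightarrow> i < m \<and> j < n \<and> E (i, j)
      | (Inr j, Inl i) \<Rightarrow> i < m \<and> j < n \<and> E (i, j)
      | _ \<Rightarrow> False)"

definition bip_path :: "nat \<Rightarrow> nat \<Rightarrow> (nat \<times> nat \<Rightarrow> bool) \<Rightarrow> nat \<Rightarrow> bvert \<Rightarrow> bvert \<Rightarrow> bvert list \<Rightarrow> bool" where
  "bip_path m n E k x y ps =
     (length ps = k + 1 \<and> distinct ps \<and> hd ps = x \<and> last ps = y \<and>
      (\<forall>i<k. bip_adj m n E (ps ! i) (ps ! Suc i)))"

definition interior :: "'a list \<Rightarrow> 'a set" where
  "interior ps = set (butlast (tl ps))"

definition many_disjoint_paths ::
  "nat \<Rightarrow> nat \<Rightarrow> (nat \<times> nat \<Rightarrow> bool) \<Rightarrow> nat \<Rightarrow> real \<Rightarrow> bvert \<Rightarrow> bvert \<Rightarrow> bool" where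
  "many_disjoint_paths m n E k N x y =
     (\<exists>P. finite P \<and> real (card P) \<ge> N \<and> (\<forall>ps\<in>P. bip_path m n E k x y ps) \<and>
          (\<forall>ps\<in>P. \<forall>qs\<in>P. ps \<noteq> qs \<longrightarrow> interior ps \<inter> interior qs = {}))"

definition bip_connect_prop ::
  "nat \<Rightarrow> nat \<Rightarrow> (nat \<times> nat \<Rightarrow> bool) \<Rightarrow> nat \<Rightarrow> nat \<Rightarrow> real \<Rightarrow> bool" where
  "bip_connect_prop m n E ks kd N =
     (\<forall>x\<in>bip_vertices m n. \<forall>y\<in>bip_vertices m n. x \<noteq> y \<longrightarrow>
        (isl x = isl y \<longrightarrow> many_disjoint_paths m n E ks N x y) \<and>
        (isl x \<noteq> isl y \<longrightarrow> many_disjoint_paths m n E kd N x y))"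

text \<open>The random bipartite graph G(m,n,p): independent Bernoulli(p) edge indicators
  (bernoulli_pmf clamps p to [0,1]).\<close>
definition rbg :: "nat \<Rightarrow> nat \<Rightarrow> real \<Rightarrow> (nat \<times> nat \<Rightarrow> bool) pmf" where
  "rbg m n p = Pi_pmf ({..<m} \<times> {..<n}) False (\<lambda>_. bernoulli_pmf p)"

end

theory Submission
  imports Defs "HOL-Real_Asymp.Real_Asymp"
begin

text \<open>
  Fix \<open>x \<noteq> y\<close> and a length \<open>k\<close> of the right parity, reserve disjoint blocks of the alternating parts as
  layers \<open>L 1, \<dots>, L (k - 1)\<close>, and grow a tree from \<open>x\<close>, exposing the edges between consecutive layers one
  level at a time. As long as \<open>p\<close> times the number of leaves is at most \<open>1/2\<close>, every leaf has with high
  probability a constant fraction of \<open>p * card (L i)\<close> private children, adjacent to no other leaf; so all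
  branches at \<open>x\<close> stay disjoint and have the same number \<open>t\<close> of leaves. In the end \<open>y\<close> is joined to each
  branch independently with probability \<open>1 - (1 - p) ^ t\<close>, every branch that is hit contributes one path,
  and a Chernoff bound for their number beats the union bound over the pairs. The hypotheses on the
  densities enter only through \<open>p * alt_prod (p * m) (p * n) r\<close>, the expected number of walks of length
  \<open>r + 1\<close> between two fixed vertices: it is of order \<open>log n\<close> or larger for \<open>r = d - 1\<close>, and \<open>o(1)\<close>, with
  room for a factor \<open>(log n)\<^sup>2\<close>, for \<open>r = d - 2\<close>.
\<close>

section \<open>Independent edges exposed in stages\<close>

text \<open>The layers are fixed before any edge is seen and consecutive pairs of them use disjoint
  sets of edges. So each level of the tree meets fresh randomness, and independence reduces to
  splitting a product measure. What stays random is the set of leaves reached; the bound for the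
  next level holds for every such set and depends only on its size, which is one reason to keep
  exact numbers of children. The two path lengths need different trees. For length d there are many
  branches, each of which may be hit with small probability. For length d + 1 one more level is
  grown, a branch is then hit with probability at least 1/2, and about (log n)^2 branches suffice;
  this restriction at the root keeps the leaves to be extended below 1 / (2 p) in number. The error
  consists of terms exp (- (log n)^4 / const), one for each leaf to be extended and together smaller
  than any power of n, and of exp (- N) with N at least 10 log n from the last exposure, which beats
  the at most 4 n^2 pairs.\<close>

abbreviation rand_edges :: "'e set \<Rightarrow> real \<Rightarrow> ('e \<Rightarrow> bool) pmf" where
  "rand_edges D p \<equiv> Pi_pmf D False (\<lambda>_. bernoulli_pmf p)"

text \<open>The form in which \<open>Pi_pmf_union\<close> merges two independent samples:
  \<open>E\<close> is the part already exposed, \<open>F\<close> the fresh one.\<close>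

definition graft :: "'e set \<Rightarrow> ('e \<Rightarrow> bool) \<Rightarrow> ('e \<Rightarrow> bool) \<Rightarrow> 'e \<Rightarrow> bool" where
  "graft A E F = (\<lambda>e. if e \<in> A then E e else F e)"

text \<open>Stands in for measurability with respect to the coordinates in \<open>D\<close>;
  independence then concerns functions local to disjoint sets.\<close>

definition local_to :: "'e set \<Rightarrow> (('e \<Rightarrow> bool) \<Rightarrow> 'b) \<Rightarrow> bool" where
  "local_to D f \<longleftrightarrow> (\<forall>E F. (\<forall>e\<in>D. E e = F e) \<longrightarrow> f E = f F)"

lemma local_toD: "local_to D f \<Longrightarrow> (\<And>e. e \<in> D \<Longrightarrow> E e = F e) \<Longrightarrow> f E = f F"
  unfolding local_to_def by blast

lemma finite_set_rand_edges: "finite D \<Longrightarrow> finite (set_pmf (rand_edges D p))"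
  by (rule finite_subset[OF set_Pi_pmf_subset']) (auto intro: finite_PiE_dflt)

lemma integrable_rand_edges:
  "finite D \<Longrightarrow> integrable (measure_pmf (rand_edges D p)) (f :: _ \<Rightarrow> real)"
  by (intro integrable_measure_pmf_finite finite_set_rand_edges)

lemma expectation_pair_pmf:
  fixes f :: "'a \<times> 'b \<Rightarrow> real"
  assumes "finite (set_pmf P)" "finite (set_pmf Q)"
  shows "measure_pmf.expectation (pair_pmf P Q) f =
    measure_pmf.expectation P (\<lambda>a. measure_pmf.expectation Q (\<lambda>b. f (a, b)))"
proof -
  have "measure_pmf.expectation (pair_pmf P Q) f =
      (\<Sum>z\<in>set_pmf P \<times> set_pmf Q. pmf (pair_pmf P Q) z *\<^sub>R f z)"
    using assms by (intro integral_measure_pmf) auto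
  also have "\<dots> = (\<Sum>a\<in>set_pmf P. \<Sum>b\<in>set_pmf Q. pmf P a * (pmf Q b * f (a, b)))"
    unfolding sum.cartesian_product by (intro sum.cong) (auto simp: pmf_pair)
  also have "\<dots> = (\<Sum>a\<in>set_pmf P. pmf P a *\<^sub>R (\<Sum>b\<in>set_pmf Q. pmf Q b *\<^sub>R f (a, b)))"
    by (simp add: sum_distrib_left)
  also have "\<dots> = (\<Sum>a\<in>set_pmf P. pmf P a *\<^sub>R measure_pmf.expectation Q (\<lambda>b. f (a, b)))"
    using assms by (subst integral_measure_pmf[where M = Q and A = "set_pmf Q"]) auto
  also have "\<dots> = measure_pmf.expectation P (\<lambda>a. measure_pmf.expectation Q (\<lambda>b. f (a, b)))"
    using assms by (subst integral_measure_pmf[where M = P and A = "set_pmf P"]) auto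
  finally show ?thesis .
qed

lemma expectation_rand_edges_Un:
  fixes f :: "('e \<Rightarrow> bool) \<Rightarrow> real"
  assumes "finite A" "finite B" "A \<inter> B = {}"
  shows "measure_pmf.expectation (rand_edges (A \<union> B) p) f =
    measure_pmf.expectation (rand_edges A p)
      (\<lambda>E. measure_pmf.expectation (rand_edges B p) (\<lambda>F. f (graft A E F)))"
  using assms
  by (subst Pi_pmf_union)
    (simp_all add: expectation_pair_pmf finite_set_rand_edges graft_def case_prod_unfold)

lemma prob_as_expectation:
  "measure_pmf.prob P {x. R x} = measure_pmf.expectation P (\<lambda>x. of_bool (R x) :: real)"
proof -
  have "measure_pmf.prob P {x. R x} = measure_pmf.expectation P (indicator {x. R x})" by simp
  also have "\<dots> = measure_pmf.expectation P (\<lambda>x. of_bool (R x) :: real)"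
    by (intro Bochner_Integration.integral_cong) (auto simp: indicator_def)
  finally show ?thesis .
qed

text \<open>For each \<open>E\<close> the inner probability is at least
  \<open>of_bool (R E) - \<eta>\<close>: by \<open>step\<close> if \<open>R E\<close> holds,
  trivially otherwise. Averaging over \<open>E\<close>, a stage costs an additive error, and no
  conditional probabilities are needed.\<close>

lemma prob_two_stage:
  assumes fin: "finite A" "finite B" and disj: "A \<inter> B = {}" and "\<eta> \<ge> 0"
    and step: "\<And>E. R E \<Longrightarrow> measure_pmf.prob (rand_edges B p) {F. Q (graft A E F)} \<ge> 1 - \<eta>"
  shows "measure_pmf.prob (rand_edges (A \<union> B) p) {E. Q E}
    \<ge> measure_pmf.prob (rand_edges A p) {E. R E} - \<eta>"
proof -
  have "measure_pmf.prob (rand_edges A p) {E. R E} - \<eta> =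
      measure_pmf.expectation (rand_edges A p) (\<lambda>E. of_bool (R E) - \<eta>)"
    using fin by (subst Bochner_Integration.integral_diff)
      (auto simp: prob_as_expectation intro: integrable_rand_edges)
  also have "\<dots> \<le> measure_pmf.expectation (rand_edges A p)
      (\<lambda>E. measure_pmf.prob (rand_edges B p) {F. Q (graft A E F)})"
  proof (intro integral_mono integrable_rand_edges fin)
    fix E
    show "of_bool (R E) - \<eta> \<le> measure_pmf.prob (rand_edges B p) {F. Q (graft A E F)}"
      using step[of E] \<open>\<eta> \<ge> 0\<close> by (cases "R E") (auto intro: order_trans[OF _ measure_nonneg])
  qed
  also have "\<dots> = measure_pmf.prob (rand_edges (A \<union> B) p) {E. Q E}"
    by (simp add: prob_as_expectation expectation_rand_edges_Un[OF fin disj])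
  finally show ?thesis .
qed

text \<open>Peel off one block: after grafting, the factor of \<open>v\<close> sees only
  \<open>E\<close> and the other factors only \<open>F\<close>, so the double expectation
  splits.\<close>

lemma expectation_prod_blocks:
  fixes f :: "'v \<Rightarrow> ('e \<Rightarrow> bool) \<Rightarrow> real"
  assumes "finite L" and "\<And>v. v \<in> L \<Longrightarrow> finite (D v)"
    and "\<And>v w. v \<in> L \<Longrightarrow> w \<in> L \<Longrightarrow> v \<noteq> w \<Longrightarrow> D v \<inter> D w = {}"
    and "\<And>v. v \<in> L \<Longrightarrow> local_to (D v) (f v)"
  shows "measure_pmf.expectation (rand_edges (\<Union>v\<in>L. D v) p) (\<lambda>E. \<Prod>v\<in>L. f v E) =
    (\<Prod>v\<in>L. measure_pmf.expectation (rand_edges (D v) p) (f v))"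
  using assms
proof (induction L rule: finite_induct)
  case (insert v L)
  let ?U = "\<Union>w\<in>L. D w"
  have disj: "D v \<inter> ?U = {}" using insert.prems(2) insert.hyps by blast
  have 1: "f v (graft (D v) E F) = f v E" for E F
    by (rule local_toD[of "D v" "f v", OF insert.prems(3)]) (auto simp: graft_def)
  have 2: "f w (graft (D v) E F) = f w F" if "w \<in> L" for w E F
    by (rule local_toD[of "D w" "f w", OF insert.prems(3)]) (use that disj in \<open>auto simp: graft_def\<close>)
  have "measure_pmf.expectation (rand_edges (\<Union>w\<in>insert v L. D w) p) (\<lambda>E. \<Prod>w\<in>insert v L. f w E) =
     measure_pmf.expectation (rand_edges (D v) p) (\<lambda>E.
       measure_pmf.expectation (rand_edges ?U p) (\<lambda>F. f v E * (\<Prod>w\<in>L. f w F)))"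
    using insert disj
    by (simp add: expectation_rand_edges_Un 1 2 cong: prod.cong)
  also have "\<dots> = measure_pmf.expectation (rand_edges (D v) p) (f v) *
      measure_pmf.expectation (rand_edges ?U p) (\<lambda>F. \<Prod>w\<in>L. f w F)"
    by simp
  also have "measure_pmf.expectation (rand_edges ?U p) (\<lambda>F. \<Prod>w\<in>L. f w F) =
      (\<Prod>w\<in>L. measure_pmf.expectation (rand_edges (D w) p) (f w))"
    using insert.prems by (intro insert.IH) auto
  finally show ?case using insert.hyps by simp
qed simp

text \<open>Lower-tail Chernoff bound, by Markov's inequality for \<open>2\<close> to the power minus the count.\<close>

lemma prob_count_blocks:
  fixes X :: "'v \<Rightarrow> ('e \<Rightarrow> bool) \<Rightarrow> bool"
  assumes fin: "finite L" "\<And>v. v \<in> L \<Longrightarrow> finite (D v)"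
    and disj: "\<And>v w. v \<in> L \<Longrightarrow> w \<in> L \<Longrightarrow> v \<noteq> w \<Longrightarrow> D v \<inter> D w = {}"
    and loc: "\<And>v. v \<in> L \<Longrightarrow> local_to (D v) (X v)"
    and q: "\<And>v. v \<in> L \<Longrightarrow> measure_pmf.prob (rand_edges (D v) p) {E. X v E} \<ge> q" and "q \<ge> 0" "q \<le> 1"
  shows "measure_pmf.prob (rand_edges (\<Union>v\<in>L. D v) p) {E. real (card {v\<in>L. X v E}) \<ge> q * card L / 4}
    \<ge> 1 - exp (- (q * card L / 4))"
proof -
  let ?M = "rand_edges (\<Union>v\<in>L. D v) p"
  \<comment> \<open>The expectation of 2 to the minus count is at most exp (- 2 c), and Markov's
    inequality at the threshold \<open>c\<close> costs a factor exp c.\<close>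
  define c where "c = q * card L / 4"
  have c0: "c \<ge> 0" using \<open>q \<ge> 0\<close> by (simp add: c_def)
  have finU: "finite (\<Union>v\<in>L. D v)" using fin by auto
  define f where "f = (\<lambda>v E. 1 - of_bool (X v E) / 2 :: real)"
  have f_prod: "(\<Prod>v\<in>L. f v E) = (1/2) ^ card {v\<in>L. X v E}" for E
  proof -
    have "(\<Prod>v\<in>L. f v E) = (\<Prod>v\<in>L. if X v E then 1/2 else 1)"
      by (intro prod.cong) (auto simp: f_def)
    also have "\<dots> = (\<Prod>v\<in>{v\<in>L. X v E}. 1/2)"
      using fin(1) by (simp add: prod.If_cases Int_def)
    finally show ?thesis by simp
  qed
  have Ef: "measure_pmf.expectation (rand_edges (D v) p) (f v) \<le> exp (- q / 2)" if "v \<in> L" for v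
  proof -
    have "measure_pmf.expectation (rand_edges (D v) p) (f v) =
        1 - measure_pmf.prob (rand_edges (D v) p) {E. X v E} / 2"
      unfolding f_def using fin(2)[OF that]
      by (subst Bochner_Integration.integral_diff)
        (auto simp: prob_as_expectation intro: integrable_rand_edges)
    also have "\<dots> \<le> 1 + (- q / 2)" using q[OF that] by simp
    also have "\<dots> \<le> exp (- q / 2)" by (rule exp_ge_add_one_self)
    finally show ?thesis .
  qed
  have Ef0: "0 \<le> measure_pmf.expectation (rand_edges (D v) p) (f v)" for v
    by (rule Bochner_Integration.integral_nonneg) (simp add: f_def)
  have loc_f: "local_to (D v) (f v)" if "v \<in> L" for v
    unfolding local_to_def f_def
  proof (intro allI impI)
    fix E F :: "'e \<Rightarrow> bool" assume "\<forall>e\<in>D v. E e = F e"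
    then have "X v E = X v F" using local_toD[of "D v" "X v" E F, OF loc[OF that]] by blast
    then show "1 - of_bool (X v E) / 2 = (1 - of_bool (X v F) / 2 :: real)" by simp
  qed
  have "measure_pmf.expectation ?M (\<lambda>E. (1/2) ^ card {v\<in>L. X v E}) =
      measure_pmf.expectation ?M (\<lambda>E. \<Prod>v\<in>L. f v E)"
    by (simp add: f_prod)
  also have "\<dots> = (\<Prod>v\<in>L. measure_pmf.expectation (rand_edges (D v) p) (f v))"
    using fin disj loc_f by (intro expectation_prod_blocks)
  also have "\<dots> \<le> (\<Prod>v\<in>L. exp (- q / 2))"
    using Ef Ef0 by (intro prod_mono) auto
  also have "\<dots> = exp (- (2 * c))"
    by (simp add: c_def flip: exp_of_nat_mult)
  finally have E: "measure_pmf.expectation ?M (\<lambda>E. (1/2) ^ card {v\<in>L. X v E}) \<le> exp (- (2 * c))" .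
  \<comment> \<open>A count below \<open>c\<close> gives 2 ^ count \<le> exp c because 2 \<le> exp
    1.\<close>
  have pt: "of_bool (real (card {v\<in>L. X v E}) < c) \<le> exp c * (1/2) ^ card {v\<in>L. X v E}" for E
  proof (cases "real (card {v\<in>L. X v E}) < c")
    case True
    let ?k = "card {v\<in>L. X v E}"
    have "(2::real) ^ ?k \<le> exp 1 ^ ?k" using exp_ge_add_one_self[of 1] by (intro power_mono) auto
    also have "\<dots> = exp (real ?k)" by (simp flip: exp_of_nat_mult)
    also have "\<dots> \<le> exp c" using True by simp
    finally show ?thesis by (simp add: power_divide field_simps)
  qed simp
  have "measure_pmf.prob ?M {E. real (card {v\<in>L. X v E}) < c} \<le>
      measure_pmf.expectation ?M (\<lambda>E. exp c * (1/2) ^ card {v\<in>L. X v E})"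
    unfolding prob_as_expectation using pt by (intro integral_mono integrable_rand_edges finU)
  also have "\<dots> = exp c * measure_pmf.expectation ?M (\<lambda>E. (1/2) ^ card {v\<in>L. X v E})"
    by simp
  also have "\<dots> \<le> exp c * exp (- (2 * c))"
    using E by (intro mult_left_mono) auto
  also have "\<dots> = exp (- c)" by (simp flip: exp_add)
  finally have "measure_pmf.prob ?M {E. real (card {v\<in>L. X v E}) < c} \<le> exp (- c)" .
  moreover have "measure_pmf.prob ?M {E. real (card {v\<in>L. X v E}) \<ge> c} =
      1 - measure_pmf.prob ?M {E. real (card {v\<in>L. X v E}) < c}"
  proof -
    have "{E. real (card {v\<in>L. X v E}) \<ge> c} = UNIV - {E. real (card {v\<in>L. X v E}) < c}" by auto
    then show ?thesis by (simp add: measure_pmf.prob_compl[simplified])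
  qed
  ultimately show ?thesis by (simp add: c_def)
qed

text \<open>Agreement on \<open>D\<close> is symmetric, so one implication is enough.\<close>

lemma local_to_predI:
  assumes "\<And>E F. (\<And>e. e \<in> D \<Longrightarrow> E e = F e) \<Longrightarrow> X E \<Longrightarrow> X F"
  shows "local_to D X"
  unfolding local_to_def
proof (intro allI impI)
  fix E F :: "'a \<Rightarrow> bool" assume agree: "\<forall>e\<in>D. E e = F e"
  have "X E \<Longrightarrow> X F" by (rule assms[of E F]) (use agree in auto)
  moreover have "X F \<Longrightarrow> X E" by (rule assms[of F E]) (use agree in auto)
  ultimately show "X E = X F" by blast
qed

text \<open>The coordinates outside \<open>A\<close> integrate out. This replaces the edges at a
  random set of leaves by all edges between two layers, a set fixed in advance.\<close>

lemma prob_rand_edges_subset: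
  fixes p :: real
  assumes "finite B" "A \<subseteq> B" "local_to A X"
  shows "measure_pmf.prob (rand_edges B p) {E. X E} = measure_pmf.prob (rand_edges A p) {E. X E}"
proof -
  have "finite A" using assms(1,2) by (rule rev_finite_subset)
  have eq: "X (graft A E F) = X E" for E F
    by (rule local_toD[OF assms(3)]) (auto simp: graft_def)
  have B: "B = A \<union> (B - A)" using assms(2) by blast
  have "measure_pmf.expectation (rand_edges (A \<union> (B - A)) p) (\<lambda>E. of_bool (X E) :: real) =
      measure_pmf.expectation (rand_edges A p) (\<lambda>E. of_bool (X E))"
    using assms(1) \<open>finite A\<close> by (subst expectation_rand_edges_Un) (auto simp: eq)
  then show ?thesis using B by (simp add: prob_as_expectation)
qed

lemma prob_Ball_ge:
  fixes P :: "'a pmf"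
  assumes "finite S" "\<And>s. s \<in> S \<Longrightarrow> measure_pmf.prob P {x. X s x} \<ge> 1 - \<eta> s"
  shows "measure_pmf.prob P {x. \<forall>s\<in>S. X s x} \<ge> 1 - (\<Sum>s\<in>S. \<eta> s)"
proof -
  have "measure_pmf.prob P (- {x. \<forall>s\<in>S. X s x}) = measure_pmf.prob P (\<Union>s\<in>S. - {x. X s x})"
    by (rule arg_cong[where f = "measure_pmf.prob P"]) auto
  also have "\<dots> \<le> (\<Sum>s\<in>S. measure_pmf.prob P (- {x. X s x}))"
    using assms(1) by (intro measure_pmf.finite_measure_subadditive_finite) auto
  also have "\<dots> \<le> (\<Sum>s\<in>S. \<eta> s)"
    using assms(2) measure_pmf.prob_compl[of _ P]
    by (intro sum_mono) (fastforce simp: Compl_eq_Diff_UNIV)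
  finally show ?thesis
    using measure_pmf.prob_compl[of "{x. \<forall>s\<in>S. X s x}" P] by (simp add: Compl_eq_Diff_UNIV)
qed

section \<open>One level of the tree: private children\<close>

text \<open>The exact value is p (1 - p) ^ (card S - 1); Bernoulli's inequality and
  \<open>p * card S \<le> 1 / 2\<close> keep the second factor at least 1/2.\<close>

lemma prob_private_edge:
  fixes h :: "'v \<times> 'v \<Rightarrow> 'e" and p :: real
  assumes "finite S" "s \<in> S" "inj_on (\<lambda>s. h (s, v)) S" "0 \<le> p" "p \<le> 1" "p * card S \<le> 1 / 2"
  shows "measure_pmf.prob (rand_edges ((\<lambda>s. h (s, v)) ` S) p)
    {E. E (h (s, v)) \<and> (\<forall>s'\<in>S - {s}. \<not> E (h (s', v)))} \<ge> p / 2"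
proof -
  let ?A = "(\<lambda>s. h (s, v)) ` S"
  \<comment> \<open>The event prescribes the value of every edge at \<open>v\<close>, so it is a box
    and its probability is a product.\<close>
  have "{E. E (h (s, v)) \<and> (\<forall>s'\<in>S - {s}. \<not> E (h (s', v)))} = Pi ?A (\<lambda>e. {e = h (s, v)})"
    using assms(2,3) by (auto simp: Pi_def inj_on_def)
  then have "measure_pmf.prob (rand_edges ?A p)
      {E. E (h (s, v)) \<and> (\<forall>s'\<in>S - {s}. \<not> E (h (s', v)))} =
      (\<Prod>e\<in>?A. measure_pmf.prob (bernoulli_pmf p) {e = h (s, v)})"
    using assms(1) by (simp add: measure_Pi_pmf_Pi)
  also have "\<dots> = (\<Prod>s'\<in>S. measure_pmf.prob (bernoulli_pmf p) {h (s', v) = h (s, v)})"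
    using assms(3) by (simp add: prod.reindex)
  also have "\<dots> = (\<Prod>s'\<in>S. if s' = s then p else 1 - p)"
  proof (rule prod.cong)
    fix s' assume "s' \<in> S"
    then have "(h (s', v) = h (s, v)) = (s' = s)"
      using assms(2,3) by (auto simp: inj_on_def)
    then show "measure_pmf.prob (bernoulli_pmf p) {h (s', v) = h (s, v)} = (if s' = s then p else 1 - p)"
      using assms(4,5) by (simp add: measure_pmf_single)
  qed simp
  also have "\<dots> = p * (\<Prod>s'\<in>S - {s}. 1 - p)"
    using assms(1,2) by (subst prod.remove[of S s]) (auto intro!: prod.cong)
  also have "(\<Prod>s'\<in>S - {s}. 1 - p) = (1 + (- p)) ^ (card S - 1)"
    using assms(1,2) by simp
  also have "p * \<dots> \<ge> p * (1 + real (card S - 1) * (- p))"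
    using assms by (intro mult_left_mono Bernoulli_inequality) auto
  also have "p * (1 + real (card S - 1) * (- p)) \<ge> p * (1 / 2)"
  proof (rule mult_left_mono)
    have "real (card S - 1) * p \<le> real (card S) * p" using assms(4) by (intro mult_right_mono) auto
    then show "1 / 2 \<le> 1 + real (card S - 1) * (- p)" using assms(6) by (simp add: mult.commute)
  qed (use assms in auto)
  finally show ?thesis by simp
qed

text \<open>Exactly \<open>g\<close> children per parent keep all branches equally large. The map
  \<open>h\<close> names the edge of an ordered pair, so that the tree argument need not know the
  graph.\<close>

definition child_family where
  "child_family h E S L g C \<longleftrightarrow> (\<forall>s\<in>S. C s \<subseteq> L \<and> card (C s) = g \<and> (\<forall>v\<in>C s. E (h (s, v)))) \<and>
     (\<forall>s\<in>S. \<forall>s'\<in>S. s \<noteq> s' \<longrightarrow> C s \<inter> C s' = {})"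

text \<open>Fix \<open>s\<close>. Whether \<open>v\<close> is private to \<open>s\<close> depends
  only on the edges from \<open>S\<close> to \<open>v\<close>, and these blocks are disjoint for
  different \<open>v\<close>. So \<open>prob_count_blocks\<close> applies with q = p / 2 and yields
  p card L / 8 private children, whence the 8 in the hypothesis on \<open>g\<close>. A vertex is
  private to at most one leaf, which makes the families disjoint; a union bound over
  \<open>S\<close> finishes.\<close>

lemma prob_child_family:
  fixes h :: "'v \<times> 'v \<Rightarrow> 'e" and p :: real and g :: nat
  assumes fin: "finite S" "finite L" and inj: "inj_on h (S \<times> L)"
    and p: "0 \<le> p" "p \<le> 1" "p * card S \<le> 1 / 2" and g: "8 * g \<le> p * card L"
  shows "measure_pmf.prob (rand_edges (h ` (S \<times> L)) p) {E. \<exists>C. child_family h E S L g C}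
    \<ge> 1 - card S * exp (- (p * card L / 8))"
proof -
  define priv where
    "priv = (\<lambda>s v E. E (h (s, v)) \<and> (\<forall>s'\<in>S - {s}. \<not> E (h (s', v))))"
  have D: "h ` (S \<times> L) = (\<Union>v\<in>L. (\<lambda>s. h (s, v)) ` S)" by auto
  let ?M = "rand_edges (h ` (S \<times> L)) p"
  have one: "measure_pmf.prob ?M {E. g \<le> card {v\<in>L. priv s v E}} \<ge> 1 - exp (- (p * card L / 8))"
    if "s \<in> S" for s
  proof -
    have "1 - exp (- (p / 2 * card L / 4)) \<le>
        measure_pmf.prob ?M {E. p / 2 * card L / 4 \<le> real (card {v\<in>L. priv s v E})}"
      unfolding D
    proof (rule prob_count_blocks)
      show "local_to ((\<lambda>s. h (s, v)) ` S) (priv s v)" if "v \<in> L" for v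
        using \<open>s \<in> S\<close> by (intro local_to_predI) (auto simp: priv_def)
      show "p / 2 \<le> measure_pmf.prob (rand_edges ((\<lambda>s. h (s, v)) ` S) p) {E. priv s v E}"
        if "v \<in> L" for v
        unfolding priv_def using inj that
        by (intro prob_private_edge fin p \<open>s \<in> S\<close>) (auto simp: inj_on_def)
      show "(\<lambda>s. h (s, v)) ` S \<inter> (\<lambda>s. h (s, w)) ` S = {}" if "v \<in> L" "w \<in> L" "v \<noteq> w" for v w
        using inj that by (auto simp: inj_on_def)
    qed (use fin p in auto)
    also have "\<dots> \<le> measure_pmf.prob ?M {E. g \<le> card {v\<in>L. priv s v E}}"
      using g by (intro measure_pmf.finite_measure_mono) auto
    finally show ?thesis by simp
  qed
  have "1 - (\<Sum>s\<in>S. exp (- (p * card L / 8))) \<le>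
      measure_pmf.prob ?M {E. \<forall>s\<in>S. g \<le> card {v\<in>L. priv s v E}}"
    using fin one by (intro prob_Ball_ge)
  also have "\<dots> \<le> measure_pmf.prob ?M {E. \<exists>C. child_family h E S L g C}"
  proof (intro measure_pmf.finite_measure_mono subsetI CollectI)
    fix E assume "E \<in> {E. \<forall>s\<in>S. g \<le> card {v\<in>L. priv s v E}}"
    then have "\<forall>s\<in>S. \<exists>T. T \<subseteq> {v\<in>L. priv s v E} \<and> card T = g"
      by (metis (lifting) mem_Collect_eq obtain_subset_with_card_n)
    then obtain C where C: "\<And>s. s \<in> S \<Longrightarrow> C s \<subseteq> {v\<in>L. priv s v E} \<and> card (C s) = g"
      by metis
    have "child_family h E S L g C"
      unfolding child_family_def
    proof (intro conjI ballI impI)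
      fix s s' assume "s \<in> S" "s' \<in> S" "s \<noteq> s'"
      then show "C s \<inter> C s' = {}" using C[of s] C[of s'] unfolding priv_def by blast
    qed (use C priv_def in blast)+
    then show "\<exists>C. child_family h E S L g C" by blast
  qed auto
  finally show ?thesis by simp
qed

lemma prob_some_edge:
  fixes h :: "'v \<times> 'v \<Rightarrow> 'e" and p :: real
  assumes "finite T" "inj_on (\<lambda>s. h (s, y)) T" "0 \<le> p" "p \<le> 1"
  shows "measure_pmf.prob (rand_edges ((\<lambda>s. h (s, y)) ` T) p) {E. \<exists>s\<in>T. E (h (s, y))} =
    1 - (1 - p) ^ card T"
proof -
  let ?A = "(\<lambda>s. h (s, y)) ` T"
  have "{E. \<exists>s\<in>T. E (h (s, y))} = UNIV - Pi ?A (\<lambda>e. {False})"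
    by (auto simp: Pi_def)
  then have "measure_pmf.prob (rand_edges ?A p) {E. \<exists>s\<in>T. E (h (s, y))} =
      1 - measure_pmf.prob (rand_edges ?A p) (Pi ?A (\<lambda>e. {False}))"
    using measure_pmf.prob_compl[of "Pi ?A (\<lambda>e. {False})" "rand_edges ?A p"] by simp
  also have "measure_pmf.prob (rand_edges ?A p) (Pi ?A (\<lambda>e. {False})) = (1 - p) ^ card T"
    using assms by (simp add: measure_Pi_pmf_Pi measure_pmf_single card_image)
  finally show ?thesis .
qed

section \<open>Growing a tree through layers\<close>

text \<open>\<open>w s\<close> is a path from the root through the layers \<open>L 0, \<dots>, L i\<close> to the leaf \<open>s\<close>; its branch is
  the vertex \<open>w s 1\<close>. Paths in different branches are disjoint below the root.\<close>

definition fan :: "('v \<times> 'v \<Rightarrow> 'e) \<Rightarrow> (nat \<Rightarrow> 'v set) \<Rightarrow> nat \<Rightarrow> nat \<Rightarrow> nat \<Rightarrow> ('e \<Rightarrow> bool) \<Rightarrow>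
    'v set \<Rightarrow> ('v \<Rightarrow> nat \<Rightarrow> 'v) \<Rightarrow> bool" where
  "fan h L i b t E S w \<longleftrightarrow> finite S \<and> S \<subseteq> L i \<and> card ((\<lambda>s. w s 1) ` S) = b \<and>
     (\<forall>s\<in>S. card {s'\<in>S. w s' 1 = w s 1} = t) \<and>
     (\<forall>s\<in>S. w s i = s \<and> (\<forall>j\<le>i. w s j \<in> L j) \<and> (\<forall>j<i. E (h (w s j, w s (Suc j))))) \<and>
     (\<forall>s\<in>S. \<forall>s'\<in>S. w s 1 \<noteq> w s' 1 \<longrightarrow> (\<forall>j\<in>{1..i}. w s j \<noteq> w s' j))"

lemma fan_card:
  assumes "fan h L i b t E S w"
  shows "card S = b * t"
proof -
  have "card S = (\<Sum>s\<in>S. 1)" by simp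
  also have "\<dots> = (\<Sum>c\<in>(\<lambda>s. w s 1) ` S. card {s\<in>S. w s 1 = c})"
    using assms by (subst sum.image_gen[of S _ "\<lambda>s. w s 1"]) (auto simp: fan_def)
  also have "\<dots> = (\<Sum>c\<in>(\<lambda>s. w s 1) ` S. t)"
    using assms by (intro sum.cong) (auto simp: fan_def)
  finally show ?thesis using assms by (simp add: fan_def)
qed

lemma fan_base:
  assumes "child_family h E {x} (L 1) g C" "L 0 = {x}" "finite (L 1)"
  shows "fan h L 1 g 1 E (C x) (\<lambda>v j. if j = 0 then x else v)"
proof -
  have C: "C x \<subseteq> L 1" "card (C x) = g" "\<And>v. v \<in> C x \<Longrightarrow> E (h (x, v))"
    using assms(1) by (auto simp: child_family_def)
  have "finite (C x)" using C(1) assms(3) finite_subset by blast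
  moreover have "{s'. s' \<in> C x \<and> s' = s} = {s}" if "s \<in> C x" for s using that by auto
  ultimately show ?thesis
    unfolding fan_def using C assms(2) by (auto simp: le_Suc_eq)
qed

text \<open>As the families are disjoint, each new leaf has one parent and inherits its branch, so
  every branch grows by the factor \<open>g\<close>. By \<open>g \<ge> 1\<close> no branch dies
  out.\<close>

lemma fan_step:
  fixes h :: "'v \<times> 'v \<Rightarrow> 'e"
  assumes fan: "fan h L i b t E S w" and i: "i \<ge> 1" and g: "g \<ge> 1" and "finite (L (Suc i))"
    and C: "child_family h E S (L (Suc i)) g C"
  shows "\<exists>S' w'. fan h L (Suc i) b (t * g) E S' w'"
proof -
  define S' where "S' = (\<Union>s\<in>S. C s)"
  define parent where "parent v = (SOME s. s \<in> S \<and> v \<in> C s)" for v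
  define w' where "w' v = (w (parent v))(Suc i := v)" for v
  have finS: "finite S" using fan by (simp add: fan_def)
  have CL: "C s \<subseteq> L (Suc i)" and Cg: "card (C s) = g"
    and CE: "\<And>v. v \<in> C s \<Longrightarrow> E (h (s, v))" if "s \<in> S" for s
    using C that by (auto simp: child_family_def)
  have Cdisj: "C s \<inter> C s' = {}" if "s \<in> S" "s' \<in> S" "s \<noteq> s'" for s s'
    using C that by (auto simp: child_family_def)
  have Cfin: "finite (C s)" if "s \<in> S" for s
    using CL[OF that] assms(4) by (rule finite_subset)
  have par: "parent v = s" if "s \<in> S" "v \<in> C s" for s v
  proof -
    have "parent v \<in> S \<and> v \<in> C (parent v)" unfolding parent_def by (rule someI[of _ s]) (use that in blast)
    then show ?thesis using Cdisj[of "parent v" s] that by blast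
  qed
  have par': "parent v \<in> S \<and> v \<in> C (parent v)" if "v \<in> S'" for v
    using that par unfolding S'_def by fastforce
  have w1: "w' v 1 = w (parent v) 1" for v using i by (simp add: w'_def)
  have img: "parent ` S' = S"
  proof
    show "parent ` S' \<subseteq> S" using par' by blast
    show "S \<subseteq> parent ` S'"
    proof
      fix s assume s: "s \<in> S"
      then have "C s \<noteq> {}" using Cg g by fastforce
      then obtain v where "v \<in> C s" by blast
      then show "s \<in> parent ` S'" using par[OF s] s unfolding S'_def by force
    qed
  qed
  have "fan h L (Suc i) b (t * g) E S' w'"
    unfolding fan_def
  proof (intro conjI ballI allI impI)
    show "finite S'" using finS Cfin by (simp add: S'_def)
    show "S' \<subseteq> L (Suc i)" using CL by (auto simp: S'_def)
    have "(\<lambda>v. w' v 1) ` S' = (\<lambda>s. w s 1) ` parent ` S'" by (simp only: w1 image_image)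
    also have "\<dots> = (\<lambda>s. w s 1) ` S" by (simp only: img)
    finally have "(\<lambda>v. w' v 1) ` S' = (\<lambda>s. w s 1) ` S" .
    then show "card ((\<lambda>v. w' v 1) ` S') = b" using fan by (simp add: fan_def)
  next
    fix v assume v: "v \<in> S'"
    let ?F = "{s'\<in>S. w s' 1 = w (parent v) 1}"
    have "{v'\<in>S'. w' v' 1 = w' v 1} = (\<Union>s\<in>?F. C s)"
    proof
      show "{v'\<in>S'. w' v' 1 = w' v 1} \<subseteq> (\<Union>s\<in>?F. C s)"
        unfolding w1 using par' by blast
      show "(\<Union>s\<in>?F. C s) \<subseteq> {v'\<in>S'. w' v' 1 = w' v 1}"
        unfolding w1 S'_def using par by auto
    qed
    then have "card {v'\<in>S'. w' v' 1 = w' v 1} = (\<Sum>s\<in>?F. card (C s))"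
      using finS Cfin Cdisj by (simp add: card_UN_disjoint)
    also have "\<dots> = card ?F * g" using Cg by simp
    also have "card ?F = t" using fan par'[OF v] by (simp add: fan_def)
    finally show "card {v'\<in>S'. w' v' 1 = w' v 1} = t * g" .
  next
    fix v assume v: "v \<in> S'"
    show "w' v (Suc i) = v" by (simp add: w'_def)
    show "w' v j \<in> L j" if "j \<le> Suc i" for j
      using that fan par'[OF v] v CL unfolding fan_def w'_def S'_def by (auto simp: le_Suc_eq)
    show "E (h (w' v j, w' v (Suc j)))" if "j < Suc i" for j
    proof (cases "j = i")
      case True
      have "w (parent v) i = parent v" using fan par'[OF v] by (simp add: fan_def)
      then show ?thesis using True CE[of "parent v" v] par'[OF v] by (simp add: w'_def)
    next
      case False
      then show ?thesis using that fan par'[OF v] by (simp add: w'_def fan_def)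
    qed
  next
    fix v v' j assume v: "v \<in> S'" "v' \<in> S'" and ne: "w' v 1 \<noteq> w' v' 1" and j: "j \<in> {1..Suc i}"
    show "w' v j \<noteq> w' v' j"
    proof (cases "j = Suc i")
      case True
      \<comment> \<open>At the new level the paths end in \<open>v\<close> and \<open>v'\<close>,
        which differ because their branches do.\<close>
      then show ?thesis using ne by (auto simp: w'_def)
    next
      case False
      then have "j \<in> {1..i}" using j by auto
      then have "w (parent v) j \<noteq> w (parent v') j"
        using fan ne par'[OF v(1)] par'[OF v(2)] unfolding w1 fan_def by blast
      then show ?thesis using False by (simp add: w'_def)
    qed
  qed
  then show ?thesis by blast
qed

definition layer_edges :: "('v \<times> 'v \<Rightarrow> 'e) \<Rightarrow> (nat \<Rightarrow> 'v set) \<Rightarrow> nat \<Rightarrow> 'e set" where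
  "layer_edges h L i = (\<Union>j<i. h ` (L j \<times> L (Suc j)))"

lemma layer_edges_Suc: "layer_edges h L (Suc i) = layer_edges h L i \<union> h ` (L i \<times> L (Suc i))"
  by (auto simp: layer_edges_def lessThan_Suc)

lemma finite_layer_edges: "(\<And>j. j \<le> i \<Longrightarrow> finite (L j)) \<Longrightarrow> finite (layer_edges h L i)"
  by (auto simp: layer_edges_def)

text \<open>A fan asserts only the presence of edges within its layers, hence an implication from
  \<open>E\<close> to \<open>F\<close> suffices.\<close>

lemma fan_cong:
  assumes "fan h L i b t E S w" "\<And>e. e \<in> layer_edges h L i \<Longrightarrow> E e \<Longrightarrow> F e"
  shows "fan h L i b t F S w"
proof -
  have "F (h (w s j, w s (Suc j)))" if "s \<in> S" "j < i" for s j
  proof (rule assms(2))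
    have "w s j \<in> L j" "w s (Suc j) \<in> L (Suc j)" "E (h (w s j, w s (Suc j)))"
      using assms(1) that by (auto simp: fan_def)
    then show "h (w s j, w s (Suc j)) \<in> layer_edges h L i" "E (h (w s j, w s (Suc j)))"
      using that by (auto simp: layer_edges_def)
  qed
  then show ?thesis using assms(1) by (simp add: fan_def)
qed

lemma child_family_cong:
  assumes "child_family h E S L g C" "\<And>e. e \<in> h ` (S \<times> L) \<Longrightarrow> E e \<Longrightarrow> F e"
  shows "child_family h F S L g C"
  using assms unfolding child_family_def by (metis (no_types, lifting) SigmaI imageI subsetD)

lemma local_child_family: "local_to (h ` (S \<times> L)) (\<lambda>E. \<exists>C. child_family h E S L g C)"
  by (intro local_to_predI) (metis child_family_cong)

text \<open>A level costs the number of current leaves, which is the product of the earlier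
  \<open>g\<close>, times the failure probability at one leaf; \<open>prob_two_stage\<close> adds
  these costs up. The branch size starts at \<open>g 1\<close>, since \<open>g 0\<close> counts the
  branches.\<close>

lemma prob_fan:
  fixes h :: "'v \<times> 'v \<Rightarrow> 'e" and L :: "nat \<Rightarrow> 'v set" and p :: real and g :: "nat \<Rightarrow> nat"
  assumes fin: "\<And>j. j \<le> k \<Longrightarrow> finite (L j)" and root: "L 0 = {x}" and p: "0 \<le> p" "p \<le> 1"
    and inj: "\<And>j. j < k \<Longrightarrow> inj_on h (L j \<times> L (Suc j))"
    and disj: "\<And>j. j < k \<Longrightarrow> layer_edges h L j \<inter> h ` (L j \<times> L (Suc j)) = {}"
    and g1: "\<And>j. j < k \<Longrightarrow> g j \<ge> 1"
    and g: "\<And>j. j < k \<Longrightarrow> 8 * g j \<le> p * card (L (Suc j))"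
    and small: "\<And>j. j < k \<Longrightarrow> p * (\<Prod>l<j. real (g l)) \<le> 1 / 2"
    and i: "1 \<le> i" "i \<le> k"
  shows "measure_pmf.prob (rand_edges (layer_edges h L i) p)
      {E. \<exists>S w. fan h L i (g 0) (\<Prod>j=1..<i. g j) E S w}
    \<ge> 1 - (\<Sum>j<i. (\<Prod>l<j. real (g l)) * exp (- (p * card (L (Suc j)) / 8)))"
  using i
proof (induction i rule: nat_induct_at_least)
  case base
  have "1 - card {x} * exp (- (p * card (L 1) / 8)) \<le>
      measure_pmf.prob (rand_edges (h ` ({x} \<times> L 1)) p) {E. \<exists>C. child_family h E {x} (L 1) (g 0) C}"
    using fin[of 1] inj[of 0] p g[of 0] small[of 0] base root
    by (intro prob_child_family) auto
  also have "\<dots> \<le> measure_pmf.prob (rand_edges (h ` ({x} \<times> L 1)) p) {E. \<exists>S w. fan h L 1 (g 0) 1 E S w}"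
    using fan_base[of h _ x L "g 0"] root fin[of 1] base
    by (intro measure_pmf.finite_measure_mono) (blast, simp)
  finally show ?case using root by (simp add: layer_edges_def lessThan_Suc)
next
  case (Suc i)
  let ?A = "layer_edges h L i" and ?B = "h ` (L i \<times> L (Suc i))"
  let ?t = "\<Prod>j=1..<i. g j" and ?s = "\<Prod>l<i. real (g l)"
  let ?\<eta> = "?s * exp (- (p * card (L (Suc i)) / 8))"
  have i: "i < k" "1 \<le> i" using Suc by auto
  have s: "real (g 0 * ?t) = ?s"
    using i by (simp add: lessThan_atLeast0 prod.atLeast_Suc_lessThan)
  have "measure_pmf.prob (rand_edges ?A p) {E. \<exists>S w. fan h L i (g 0) ?t E S w} - ?\<eta> \<le>
      measure_pmf.prob (rand_edges (?A \<union> ?B) p)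
        {E. \<exists>S w. fan h L (Suc i) (g 0) (?t * g i) E S w}"
  proof (rule prob_two_stage)
    show "finite ?A" using fin i by (intro finite_layer_edges) auto
    show finB: "finite ?B" using fin[of i] fin[of "Suc i"] i by auto
    show "?A \<inter> ?B = {}" using disj i by blast
    show "0 \<le> ?\<eta>" by (simp add: prod_nonneg)
    fix E assume "\<exists>S w. fan h L i (g 0) ?t E S w"
    then obtain S w where fan: "fan h L i (g 0) ?t E S w" by blast
    then have S: "finite S" "S \<subseteq> L i" "card S = g 0 * ?t"
      using fan_card[OF fan] by (auto simp: fan_def)
    have "1 - ?\<eta> = 1 - card S * exp (- (p * card (L (Suc i)) / 8))"
      using s S(3) by simp
    also have "\<dots> \<le> measure_pmf.prob (rand_edges (h ` (S \<times> L (Suc i))) p)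
        {F. \<exists>C. child_family h F S (L (Suc i)) (g i) C}"
    proof (rule prob_child_family)
      show "inj_on h (S \<times> L (Suc i))" using inj[OF i(1)] S(2) by (auto intro: inj_on_subset)
      show "p * real (card S) \<le> 1 / 2" using small[OF i(1)] s S(3) by simp
    qed (use S p fin i g in auto)
    \<comment> \<open>\<open>S\<close> depends on what was exposed, so the event is moved to the
      fixed set \<open>?B\<close> of all edges between the two layers.\<close>
    also have "\<dots> = measure_pmf.prob (rand_edges ?B p)
        {F. \<exists>C. child_family h F S (L (Suc i)) (g i) C}"
      using S by (intro prob_rand_edges_subset[symmetric] finB local_child_family) auto
    also have "\<dots> \<le> measure_pmf.prob (rand_edges ?B p)
        {F. \<exists>S w. fan h L (Suc i) (g 0) (?t * g i) (graft ?A E F) S w}"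
    proof (intro measure_pmf.finite_measure_mono subsetI CollectI)
      fix F assume "F \<in> {F. \<exists>C. child_family h F S (L (Suc i)) (g i) C}"
      then obtain C where "child_family h F S (L (Suc i)) (g i) C" by blast
      then have "child_family h (graft ?A E F) S (L (Suc i)) (g i) C"
      proof (rule child_family_cong)
        fix e assume "e \<in> h ` (S \<times> L (Suc i))" "F e"
        moreover from this have "e \<notin> ?A" using disj[OF i(1)] S(2) by blast
        ultimately show "graft ?A E F e" by (simp add: graft_def)
      qed
      moreover have "fan h L i (g 0) ?t (graft ?A E F) S w"
        using fan by (rule fan_cong) (simp add: graft_def)
      ultimately show "\<exists>S w. fan h L (Suc i) (g 0) (?t * g i) (graft ?A E F) S w"
        using i g1[of i] fin[of "Suc i"] by (intro fan_step) auto
    qed auto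
    finally show "1 - ?\<eta> \<le> measure_pmf.prob (rand_edges ?B p)
        {F. \<exists>S w. fan h L (Suc i) (g 0) (?t * g i) (graft ?A E F) S w}" .
  qed
  moreover have "?t * g i = (\<Prod>j=1..<Suc i. g j)" using i by simp
  ultimately show ?case using Suc.IH i by (simp add: layer_edges_Suc)
qed

section \<open>From a tree to disjoint paths\<close>

text \<open>Paths are functions on all natural numbers. For k \<ge> 2 distinct members of
  \<open>P\<close> differ at position 1, so values beyond \<open>k\<close> cannot inflate
  \<open>card P\<close>.\<close>

definition disjoint_layer_paths where
  "disjoint_layer_paths h L k E (P :: (nat \<Rightarrow> 'v) set) \<longleftrightarrow> finite P \<and>
     (\<forall>w\<in>P. (\<forall>j\<le>k. w j \<in> L j) \<and> (\<forall>j<k. E (h (w j, w (Suc j))))) \<and>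
     (\<forall>w\<in>P. \<forall>w'\<in>P. w \<noteq> w' \<longrightarrow> (\<forall>j\<in>{1..<k}. w j \<noteq> w' j))"

text \<open>\<open>G\<close> is a set of branches hit by \<open>y\<close>. One adjacent leaf is
  chosen in each, and the disjointness of the branches passes to the paths.\<close>

lemma disjoint_layer_paths_of_fan:
  assumes fan: "fan h L k b t E S w" and k: "k \<ge> 1" and y: "L (Suc k) = {y}"
    and G: "G \<subseteq> (\<lambda>s. w s 1) ` S" "\<And>c. c \<in> G \<Longrightarrow> \<exists>s\<in>S. w s 1 = c \<and> E (h (s, y))"
  shows "\<exists>P. disjoint_layer_paths h L (Suc k) E P \<and> card P = card G"
proof -
  obtain s where s: "\<And>c. c \<in> G \<Longrightarrow> s c \<in> S \<and> w (s c) 1 = c \<and> E (h (s c, y))"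
    using G(2) by metis
  define path where "path c = (w (s c))(Suc k := y)" for c
  have path1: "path c 1 = c" if "c \<in> G" for c
    using s[OF that] k by (simp add: path_def)
  have "inj_on path G" by (metis inj_onI path1)
  then have "card (path ` G) = card G" by (rule card_image)
  moreover have "disjoint_layer_paths h L (Suc k) E (path ` G)"
    unfolding disjoint_layer_paths_def
  proof (intro conjI ballI allI impI)
    have "finite S" using fan by (simp add: fan_def)
    then show "finite (path ` G)" using G(1) finite_subset by blast
  next
    fix u assume "u \<in> path ` G"
    then obtain c where c: "c \<in> G" "u = path c" by blast
    show "u j \<in> L j" if "j \<le> Suc k" for j
      using that c s[OF c(1)] fan y by (auto simp: path_def fan_def le_Suc_eq)
    show "E (h (u j, u (Suc j)))" if "j < Suc k" for j
    proof (cases "j = k")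
      case True
      have "w (s c) k = s c" using s[OF c(1)] fan by (simp add: fan_def)
      then show ?thesis using True c s[OF c(1)] by (simp add: path_def)
    next
      case False
      then show ?thesis using that c s[OF c(1)] fan by (simp add: path_def fan_def)
    qed
  next
    fix u u' j assume "u \<in> path ` G" "u' \<in> path ` G" "u \<noteq> u'" and j: "j \<in> {1..<Suc k}"
    then obtain c c' where c: "c \<in> G" "c' \<in> G" "u = path c" "u' = path c'" "c \<noteq> c'" by blast
    then have "w (s c) j \<noteq> w (s c') j"
      using s[OF c(1)] s[OF c(2)] fan j unfolding fan_def by auto
    then show "u j \<noteq> u' j" using c j by (simp add: path_def)
  qed
  ultimately show ?thesis by blast
qed

text \<open>A single \<open>q\<close> serves all branches because they have the same number of
  leaves. The sum is the error of \<open>prob_fan\<close>, the last exponential that of the Chernoff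
  bound over the \<open>g 0\<close> branches.\<close>

lemma prob_disjoint_layer_paths:
  fixes h :: "'v \<times> 'v \<Rightarrow> 'e" and L :: "nat \<Rightarrow> 'v set" and p q :: real and g :: "nat \<Rightarrow> nat"
  assumes k: "k \<ge> 1" and fin: "\<And>j. j \<le> k \<Longrightarrow> finite (L j)"
    and root: "L 0 = {x}" and y: "L (Suc k) = {y}" and p: "0 \<le> p" "p \<le> 1"
    and inj: "\<And>j. j \<le> k \<Longrightarrow> inj_on h (L j \<times> L (Suc j))"
    and disj: "\<And>j. j \<le> k \<Longrightarrow> layer_edges h L j \<inter> h ` (L j \<times> L (Suc j)) = {}"
    and g1: "\<And>j. j < k \<Longrightarrow> g j \<ge> 1"
    and g: "\<And>j. j < k \<Longrightarrow> 8 * g j \<le> p * card (L (Suc j))"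
    and small: "\<And>j. j < k \<Longrightarrow> p * (\<Prod>l<j. real (g l)) \<le> 1 / 2"
    and q: "0 \<le> q" "q \<le> 1 - (1 - p) ^ (\<Prod>j=1..<k. g j)"
  shows "measure_pmf.prob (rand_edges (layer_edges h L (Suc k)) p)
      {E. \<exists>P. disjoint_layer_paths h L (Suc k) E P \<and> q * g 0 / 4 \<le> card P}
    \<ge> 1 - (\<Sum>j<k. (\<Prod>l<j. real (g l)) * exp (- (p * card (L (Suc j)) / 8))) - exp (- (q * g 0 / 4))"
proof -
  let ?A = "layer_edges h L k" and ?B = "h ` (L k \<times> L (Suc k))"
  let ?t = "\<Prod>j=1..<k. g j"
  let ?\<eta> = "exp (- (q * g 0 / 4))"
  have "q \<le> 1" using q(2) p by (smt (verit) zero_le_power)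
  have "measure_pmf.prob (rand_edges ?A p) {E. \<exists>S w. fan h L k (g 0) ?t E S w} - ?\<eta> \<le>
      measure_pmf.prob (rand_edges (?A \<union> ?B) p)
        {E. \<exists>P. disjoint_layer_paths h L (Suc k) E P \<and> q * g 0 / 4 \<le> card P}"
  proof (rule prob_two_stage)
    show "finite ?A" using fin by (intro finite_layer_edges) auto
    show finB: "finite ?B" using fin[of k] y by auto
    show "?A \<inter> ?B = {}" using disj by blast
    fix E assume "\<exists>S w. fan h L k (g 0) ?t E S w"
    then obtain S w where fan: "fan h L k (g 0) ?t E S w" by blast
    then have S: "finite S" "S \<subseteq> L k" by (auto simp: fan_def)
    define R where "R = (\<lambda>s. w s 1) ` S"
    have cardR: "card R = g 0" using fan by (simp add: fan_def R_def)
    define fib where "fib c = {s\<in>S. w s 1 = c}" for c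
    define X where "X c F \<longleftrightarrow> (\<exists>s\<in>fib c. F (h (s, y)))" for c and F :: "'e \<Rightarrow> bool"
    have injy: "inj_on (\<lambda>s. h (s, y)) S"
      using inj[of k] S(2) y by (auto simp: inj_on_def)
    \<comment> \<open>The edges at \<open>y\<close> split into one block per branch; the blocks are
      disjoint by \<open>injy\<close>.\<close>
    have D: "h ` (S \<times> {y}) = (\<Union>c\<in>R. (\<lambda>s. h (s, y)) ` fib c)"
      by (auto simp: R_def fib_def)
    have locX: "local_to ((\<lambda>s. h (s, y)) ` fib c) (X c)" for c
      by (intro local_to_predI) (auto simp: X_def)
    have "1 - ?\<eta> = 1 - exp (- (q * card R / 4))" by (simp add: cardR)
    also have "\<dots> \<le> measure_pmf.prob (rand_edges (h ` (S \<times> {y})) p)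
        {F. q * card R / 4 \<le> card {c\<in>R. X c F}}"
      unfolding D
    proof (rule prob_count_blocks)
      show "(\<lambda>s. h (s, y)) ` fib v \<inter> (\<lambda>s. h (s, y)) ` fib v' = {}" if "v \<noteq> v'" for v v'
        using injy that by (auto simp: fib_def inj_on_def)
      show "q \<le> measure_pmf.prob (rand_edges ((\<lambda>s. h (s, y)) ` fib c) p) {F. X c F}"
        if "c \<in> R" for c
      proof -
        have "card (fib c) = ?t" using fan that by (auto simp: fan_def fib_def R_def)
        moreover have "inj_on (\<lambda>s. h (s, y)) (fib c)" "finite (fib c)"
          using injy S(1) by (auto simp: fib_def inj_on_def)
        ultimately show ?thesis
          using q(2) p prob_some_edge[of "fib c" h y p] by (simp add: X_def)
      qed
    qed (use S locX q(1) \<open>q \<le> 1\<close> in \<open>auto simp: R_def fib_def\<close>)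
    also have "\<dots> = measure_pmf.prob (rand_edges ?B p) {F. q * card R / 4 \<le> card {c\<in>R. X c F}}"
    proof (rule prob_rand_edges_subset[symmetric, OF finB])
      show "local_to (h ` (S \<times> {y})) (\<lambda>F. q * card R / 4 \<le> card {c\<in>R. X c F})"
      proof (rule local_to_predI)
        fix F F' :: "'e \<Rightarrow> bool"
        assume "\<And>e. e \<in> h ` (S \<times> {y}) \<Longrightarrow> F e = F' e"
        then have "F (h (s, y)) = F' (h (s, y))" if "s \<in> S" for s using that by auto
        then have "{c\<in>R. X c F} = {c\<in>R. X c F'}" by (auto simp: X_def fib_def)
        then show "q * card R / 4 \<le> card {c\<in>R. X c F} \<Longrightarrow> q * card R / 4 \<le> card {c\<in>R. X c F'}"
          by simp
      qed
    qed (use S y in auto)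
    also have "\<dots> \<le> measure_pmf.prob (rand_edges ?B p)
      {F. \<exists>P. disjoint_layer_paths h L (Suc k) (graft ?A E F) P \<and> q * g 0 / 4 \<le> card P}"
    proof (intro measure_pmf.finite_measure_mono subsetI CollectI)
      fix F assume "F \<in> {F. q * card R / 4 \<le> card {c\<in>R. X c F}}"
      then have F: "q * g 0 / 4 \<le> card {c\<in>R. X c F}" by (simp add: cardR)
      have fan': "fan h L k (g 0) ?t (graft ?A E F) S w"
        using fan by (rule fan_cong) (simp add: graft_def)
      have "\<exists>P. disjoint_layer_paths h L (Suc k) (graft ?A E F) P \<and> card P = card {c\<in>R. X c F}"
      proof (rule disjoint_layer_paths_of_fan[OF fan' k y])
        fix c assume "c \<in> {c\<in>R. X c F}"
        then obtain s where s: "s \<in> S" "w s 1 = c" "F (h (s, y))" by (auto simp: X_def fib_def)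
        then have "h (s, y) \<in> ?B" using S y by auto
        then have "h (s, y) \<notin> ?A" using disj[of k] by blast
        then show "\<exists>s\<in>S. w s 1 = c \<and> graft ?A E F (h (s, y))"
          using s by (auto simp: graft_def)
      qed (auto simp: R_def)
      then show "\<exists>P. disjoint_layer_paths h L (Suc k) (graft ?A E F) P \<and> q * g 0 / 4 \<le> card P"
        using F by auto
    qed auto
    finally show "1 - ?\<eta> \<le> measure_pmf.prob (rand_edges ?B p)
      {F. \<exists>P. disjoint_layer_paths h L (Suc k) (graft ?A E F) P \<and> q * g 0 / 4 \<le> card P}" .
  qed auto
  moreover have "1 - (\<Sum>j<k. (\<Prod>l<j. real (g l)) * exp (- (p * card (L (Suc j)) / 8))) \<le>
      measure_pmf.prob (rand_edges ?A p) {E. \<exists>S w. fan h L k (g 0) ?t E S w}"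
    using k by (intro prob_fan[where x = x] fin root p inj disj g1 g small) auto
  ultimately show ?thesis by (simp add: layer_edges_Suc)
qed

section \<open>Layers in the bipartite graph\<close>

text \<open>Consecutive layers lead from U to V or back, so both orientations of an edge get the
  same name. Two vertices of one part get a dummy value, which the hypothesis
  \<open>isl u \<noteq> isl v\<close> of the lemmas below excludes.\<close>

fun edge_key :: "bvert \<times> bvert \<Rightarrow> nat \<times> nat" where
  "edge_key (Inl i, Inr j) = (i, j)"
| "edge_key (Inr j, Inl i) = (i, j)"
| "edge_key _ = (0, 0)"

lemma edge_key_eqD:
  assumes "edge_key (u, v) = edge_key (u', v')" "isl u \<noteq> isl v" "isl u' \<noteq> isl v'"
  shows "(u' = u \<and> v' = v) \<or> (u' = v \<and> v' = u)"
  using assms by (cases u; cases v; cases u'; cases v') auto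

lemma bip_adjI:
  assumes "u \<in> bip_vertices m n" "v \<in> bip_vertices m n" "isl u \<noteq> isl v" "E (edge_key (u, v))"
  shows "bip_adj m n E u v"
  using assms by (auto simp: bip_vertices_def bip_adj_def)

lemma edge_key_in:
  assumes "u \<in> bip_vertices m n" "v \<in> bip_vertices m n" "isl u \<noteq> isl v"
  shows "edge_key (u, v) \<in> {..<m} \<times> {..<n}"
  using assms by (auto simp: bip_vertices_def)

text \<open>\<open>c\<close> tells whether layer 0 lies in U; the Boolean equation
  \<open>c = even i\<close> then tells it for layer \<open>i\<close>.\<close>

definition bip_layers :: "nat \<Rightarrow> nat \<Rightarrow> nat \<Rightarrow> bool \<Rightarrow> (nat \<Rightarrow> bvert set) \<Rightarrow> bool" where
  "bip_layers m n k c L \<longleftrightarrow>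
     (\<forall>i\<le>k. L i \<subseteq> {v \<in> bip_vertices m n. isl v = (c = even i)}) \<and>
     (\<forall>i\<le>k. \<forall>j\<le>k. i \<noteq> j \<longrightarrow> L i \<inter> L j = {})"

lemma finite_bip_vertices: "finite (bip_vertices m n)"
  by (simp add: bip_vertices_def)

lemma interior_map_upt: "interior (map w [0..<Suc k]) = w ` {1..<k}"
proof (cases k)
  case (Suc l)
  have "[0..<Suc k] = 0 # [1..<k] @ [k]"
    using Suc by (metis One_nat_def upt_Suc_append upt_conv_Cons zero_less_Suc le0 Suc_le_mono append_Cons)
  then have "map w [0..<Suc k] = w 0 # map w [1..<k] @ [w k]" by (metis list.map map_append)
  then show ?thesis by (simp add: interior_def del: upt_Suc)
qed (simp add: interior_def)

lemma local_disjoint_layer_paths: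
  fixes h :: "'v \<times> 'v \<Rightarrow> 'e"
  shows "local_to (layer_edges h L' k') (\<lambda>E. \<exists>P. disjoint_layer_paths h L' k' E P \<and> N \<le> real (card P))"
proof (rule local_to_predI)
  fix E F :: "'e \<Rightarrow> bool"
  assume eq: "\<And>e. e \<in> layer_edges h L' k' \<Longrightarrow> E e = F e"
  assume "\<exists>P. disjoint_layer_paths h L' k' E P \<and> N \<le> real (card P)"
  then obtain P where P: "disjoint_layer_paths h L' k' E P" "N \<le> card P" by blast
  have "F (h (w j, w (Suc j)))" if "w \<in> P" "j < k'" for w j
  proof -
    have "w j \<in> L' j" "w (Suc j) \<in> L' (Suc j)" "E (h (w j, w (Suc j)))"
      using P(1) that by (auto simp: disjoint_layer_paths_def)
    moreover from this have "h (w j, w (Suc j)) \<in> layer_edges h L' k'"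
      using that by (auto simp: layer_edges_def)
    ultimately show ?thesis using eq by blast
  qed
  then have "disjoint_layer_paths h L' k' F P" using P(1) by (simp add: disjoint_layer_paths_def)
  then show "\<exists>P. disjoint_layer_paths h L' k' F P \<and> N \<le> real (card P)" using P(2) by blast
qed

context
  fixes m n k c L
  assumes layers: "bip_layers m n k c L"
begin

lemma bip_layers_vertex: "i \<le> k \<Longrightarrow> v \<in> L i \<Longrightarrow> v \<in> bip_vertices m n"
  and bip_layers_side: "i \<le> k \<Longrightarrow> v \<in> L i \<Longrightarrow> isl v = (c = even i)"
  and bip_layers_disjoint: "i \<le> k \<Longrightarrow> j \<le> k \<Longrightarrow> v \<in> L i \<Longrightarrow> v \<in> L j \<Longrightarrow> i = j"
  using layers unfolding bip_layers_def by blast+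

lemma bip_layers_finite: "i \<le> k \<Longrightarrow> finite (L i)"
  using bip_layers_vertex finite_subset[OF _ finite_bip_vertices] by blast

text \<open>A name determines its edge up to orientation, and a reversal would need both j = i + 1
  and i = j + 1. So an edge belongs to at most one step between layers and is fresh when that step
  is exposed.\<close>

lemma bip_layers_key_eqD:
  assumes "i < k" "j < k" "u \<in> L i" "v \<in> L (Suc i)" "u' \<in> L j" "v' \<in> L (Suc j)"
    and "edge_key (u, v) = edge_key (u', v')"
  shows "i = j \<and> u = u' \<and> v = v'"
proof -
  have "isl u \<noteq> isl v"
    using bip_layers_side[of i u] bip_layers_side[of "Suc i" v] assms by auto
  moreover have "isl u' \<noteq> isl v'"
    using bip_layers_side[of j u'] bip_layers_side[of "Suc j" v'] assms by auto
  ultimately consider "u' = u" "v' = v" | "u' = v" "v' = u"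
    using edge_key_eqD[OF assms(7)] by blast
  then show ?thesis
  proof cases
    case 1
    then show ?thesis using bip_layers_disjoint[of i j u] assms by auto
  next
    case 2
    then have "j = Suc i" "Suc j = i"
      using bip_layers_disjoint[of "Suc i" j v] bip_layers_disjoint[of i "Suc j" u] assms by auto
    then show ?thesis by simp
  qed
qed

lemma bip_layers_inj: "i < k \<Longrightarrow> inj_on edge_key (L i \<times> L (Suc i))"
  using bip_layers_key_eqD[of i i] by (fastforce simp: inj_on_def)

lemma bip_layers_edges_disjoint:
  assumes "i < k"
  shows "layer_edges edge_key L i \<inter> edge_key ` (L i \<times> L (Suc i)) = {}"
proof (rule ccontr)
  assume "\<not> ?thesis"
  then obtain e where "e \<in> layer_edges edge_key L i" "e \<in> edge_key ` (L i \<times> L (Suc i))" by blast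
  then obtain j u v u' v' where "j < i" "u \<in> L j" "v \<in> L (Suc j)" "u' \<in> L i" "v' \<in> L (Suc i)"
    "edge_key (u, v) = edge_key (u', v')"
    unfolding layer_edges_def by auto
  then show False using bip_layers_key_eqD[of j i u v u' v'] assms by simp
qed

lemma bip_layers_edges: "layer_edges edge_key L k \<subseteq> {..<m} \<times> {..<n}"
proof
  fix e assume "e \<in> layer_edges edge_key L k"
  then obtain i u v where i: "i < k" "u \<in> L i" "v \<in> L (Suc i)" "e = edge_key (u, v)"
    unfolding layer_edges_def by auto
  then show "e \<in> {..<m} \<times> {..<n}"
    using bip_layers_vertex[of i u] bip_layers_vertex[of "Suc i" v]
      bip_layers_side[of i u] bip_layers_side[of "Suc i" v]
    by (metis Suc_leI edge_key_in even_Suc less_imp_le)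
qed

text \<open>As the layers are disjoint, a walk through them repeats no vertex, and two walks can
  meet only at equal positions, which \<open>disjoint_layer_paths\<close> forbids in the interior.
  By k \<ge> 2 there is an inner position that tells the vertex lists apart.\<close>

lemma many_disjoint_paths_of_layers:
  assumes P: "disjoint_layer_paths edge_key L k E P" "N \<le> real (card P)"
    and k: "k \<ge> 2" and ends: "L 0 = {x}" "L k = {y}"
  shows "many_disjoint_paths m n E k N x y"
proof -
  define f where "f w = map w [0..<Suc k]" for w :: "nat \<Rightarrow> bvert"
  have f_nth: "f w ! j = w j" if "j \<le> k" for w j
    using that unfolding f_def by (simp del: upt_Suc)
  have PL: "w j \<in> L j" if "w \<in> P" "j \<le> k" for w j
    using P(1) that by (simp add: disjoint_layer_paths_def)
  have PE: "E (edge_key (w j, w (Suc j)))" if "w \<in> P" "j < k" for w j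
    using P(1) that by (simp add: disjoint_layer_paths_def)
  have Pdisj: "w j \<noteq> w' j" if "w \<in> P" "w' \<in> P" "w \<noteq> w'" "j \<in> {1..<k}" for w w' j
    using P(1) that unfolding disjoint_layer_paths_def by blast
  have "inj_on f P"
  proof (rule inj_onI, rule ccontr)
    fix w w' assume w: "w \<in> P" "w' \<in> P" "f w = f w'" "w \<noteq> w'"
    then have "w 1 = w' 1" using f_nth[of 1] k by (metis one_le_numeral order_trans)
    then show False using Pdisj[OF w(1,2,4), of 1] k by simp
  qed
  then have "card (f ` P) = card P" by (rule card_image)
  moreover have "finite (f ` P)" using P(1) by (simp add: disjoint_layer_paths_def)
  moreover have "bip_path m n E k x y (f w)" if w: "w \<in> P" for w
    unfolding bip_path_def
  proof (intro conjI allI impI)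
    show len: "length (f w) = k + 1" by (simp add: f_def)
    have "inj_on w {0..<Suc k}"
    proof (rule inj_onI)
      fix i j assume ij: "i \<in> {0..<Suc k}" "j \<in> {0..<Suc k}" "w i = w j"
      then show "i = j"
        using bip_layers_disjoint[of i j "w i"] PL[OF w, of i] PL[OF w, of j] by auto
    qed
    then show "distinct (f w)" by (simp add: f_def distinct_map del: upt_Suc)
    have ne: "f w \<noteq> []" using len by auto
    show "hd (f w) = x" using f_nth[of 0 w] PL[OF w, of 0] ends ne by (simp add: hd_conv_nth)
    show "last (f w) = y" using f_nth[of k w] PL[OF w, of k] ends ne len by (simp add: last_conv_nth)
    fix i assume i: "i < k"
    have "bip_adj m n E (w i) (w (Suc i))"
    proof (rule bip_adjI)
      show "w i \<in> bip_vertices m n" "w (Suc i) \<in> bip_vertices m n"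
        using bip_layers_vertex[of i] bip_layers_vertex[of "Suc i"] PL[OF w] i by auto
      show "isl (w i) \<noteq> isl (w (Suc i))"
        using bip_layers_side[of i "w i"] bip_layers_side[of "Suc i" "w (Suc i)"] PL[OF w] i by auto
    qed (use PE[OF w i] in simp)
    then show "bip_adj m n E (f w ! i) (f w ! Suc i)" using f_nth i by simp
  qed
  moreover have "interior (f w) \<inter> interior (f w') = {}"
    if w: "w \<in> P" "w' \<in> P" "f w \<noteq> f w'" for w w'
  proof (rule ccontr)
    assume "interior (f w) \<inter> interior (f w') \<noteq> {}"
    then obtain i j where ij: "i \<in> {1..<k}" "j \<in> {1..<k}" "w i = w' j"
      unfolding f_def interior_map_upt by blast
    then have "i = j"
      using bip_layers_disjoint[of i j "w i"] PL[OF w(1), of i] PL[OF w(2), of j] by auto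
    then show False using Pdisj[of w w' i] ij w by auto
  qed
  ultimately show ?thesis
    unfolding many_disjoint_paths_def using P(2) by (intro exI[of _ "f ` P"]) auto
qed

end

text \<open>The inner layers take consecutive blocks of one \<open>k\<close>-th of the vertices of alternating parts;
  the end points \<open>x\<close> and \<open>y\<close> have to be removed from them.\<close>

definition block_layers :: "nat \<Rightarrow> nat \<Rightarrow> nat \<Rightarrow> bvert \<Rightarrow> bvert \<Rightarrow> nat \<Rightarrow> bvert set" where
  "block_layers m n k x y i =
     (if i = 0 then {x} else if i = k then {y}
      else if isl x = even i then Inl ` {i * (m div k)..<Suc i * (m div k)} - {x, y}
      else Inr ` {i * (n div k)..<Suc i * (n div k)} - {x, y})"

lemma block_le:
  assumes "i < (k::nat)"
  shows "Suc i * (m div k) \<le> m"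
proof -
  have "Suc i * (m div k) \<le> k * (m div k)" using assms by (intro mult_right_mono) auto
  also have "\<dots> \<le> m" by simp
  finally show ?thesis .
qed

lemma block_disjoint:
  assumes "a \<in> {i * s..<Suc i * s}" "a \<in> {j * s..<Suc j * (s::nat)}"
  shows "i = j"
proof (rule ccontr)
  assume "i \<noteq> j"
  then have "Suc i * s \<le> j * s \<or> Suc j * s \<le> i * s"
    by (metis linorder_neqE_nat mult_le_mono1 Suc_leI)
  then show False using assms by auto
qed

text \<open>The parity hypothesis places \<open>y\<close> on the side prescribed for layer
  \<open>k\<close>.\<close>

lemma bip_layers_block_layers:
  assumes x: "x \<in> bip_vertices m n" "y \<in> bip_vertices m n" "x \<noteq> y" "(isl x = isl y) = even k"
  shows "bip_layers m n k (isl x) (block_layers m n k x y)"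
  unfolding bip_layers_def
proof (intro conjI allI impI)
  fix i assume i: "i \<le> k"
  show "block_layers m n k x y i \<subseteq> {v \<in> bip_vertices m n. isl v = (isl x = even i)}"
  proof (cases "i = 0 \<or> i = k")
    case True
    then show ?thesis using x by (auto simp: block_layers_def)
  next
    case False
    then have "i < k" using i by simp
    then show ?thesis
      using False block_le[of i k m] block_le[of i k n]
      by (auto simp: block_layers_def bip_vertices_def)
  qed
  fix j assume j: "j \<le> k" "i \<noteq> j"
  show "block_layers m n k x y i \<inter> block_layers m n k x y j = {}"
  proof (rule ccontr)
    assume "\<not> ?thesis"
    then obtain v where v: "v \<in> block_layers m n k x y i" "v \<in> block_layers m n k x y j" by blast
    show False
    proof (cases "i \<in> {0, k} \<or> j \<in> {0, k}")
      case True
      then show False using v j x(3) by (auto simp: block_layers_def split: if_splits)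
    next
      case False
      show False
      proof (cases v)
        case (Inl a)
        then show False using v j \<open>\<not> (i \<in> {0, k} \<or> j \<in> {0, k})\<close> block_disjoint[of a i "m div k" j]
          by (auto simp: block_layers_def split: if_splits)
      next
        case (Inr a)
        then show False using v j \<open>\<not> (i \<in> {0, k} \<or> j \<in> {0, k})\<close> block_disjoint[of a i "n div k" j]
          by (auto simp: block_layers_def split: if_splits)
      qed
    qed
  qed
qed

text \<open>A block has more than N / k - 1 vertices and loses at most two; N / k - 3 \<ge> N / (2
  k) amounts to 6 k \<le> N.\<close>

lemma block_layers_card:
  assumes "0 < i" "i < k" "6 * k \<le> m" "6 * k \<le> n"
  shows "card (block_layers m n k x y i) \<ge> (if isl x = even i then real m else real n) / (2 * k)"
proof -
  have *: "card (c ` {i * (N div k)..<Suc i * (N div k)} - {x, y}) \<ge> real N / (2 * k)"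
    if "inj c" "6 * k \<le> N" for c :: "nat \<Rightarrow> bvert" and N
  proof -
    let ?I = "{i * (N div k)..<Suc i * (N div k)}"
    have "card (c ` ?I) = N div k"
      using that(1) by (subst card_image) (auto intro: inj_on_subset)
    then have "card (c ` ?I - {x, y}) \<ge> N div k - card {x, y}"
      using diff_card_le_card_Diff[of "{x, y}" "c ` ?I"] by simp
    moreover have "card {x, y} \<le> 2" by (simp add: card_insert_if)
    ultimately have 1: "real (card (c ` ?I - {x, y})) \<ge> real (N div k) - 2" by linarith
    have "N < k * Suc (N div k)" using assms by (metis dividend_less_times_div gr_zeroI mult_Suc_right not_less_zero)
    then have "real N < real k * (real (N div k) + 1)" by (metis of_nat_Suc of_nat_less_iff of_nat_mult add.commute)
    then have "real N / k < real (N div k) + 1" using assms by (simp add: field_simps)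
    moreover have "real N / k \<ge> 6" using that(2) assms by (simp add: field_simps)
    moreover have "real N / (2 * k) = real N / k / 2" by simp
    ultimately show ?thesis using 1 by linarith
  qed
  show ?thesis
    using *[of Inl m] *[of Inr n] assms by (auto simp: block_layers_def)
qed

text \<open>\<open>a\<close> is the size of the part opposite to \<open>x\<close>, which receives
  the children grown in step \<open>j\<close> for even \<open>j\<close>. The divisor 16 (k + 1)
  combines the 8 of \<open>prob_child_family\<close> with the share 1 / (2 (k + 1)) of a block. By
  \<open>small\<close> at most 1 / (2 p) leaves are extended at each of the \<open>k\<close>
  levels.\<close>

lemma prob_many_disjoint_paths:
  fixes p q :: real and g :: "nat \<Rightarrow> nat"
  assumes x: "x \<in> bip_vertices m n" "y \<in> bip_vertices m n" "x \<noteq> y" "(isl x = isl y) = even (Suc k)"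
    and k: "k \<ge> 1" and mn: "6 * Suc k \<le> m" "m \<le> n" and p: "0 < p" "p \<le> 1"
    and ab: "a = (if isl x then real n else real m)" "b = (if isl x then real m else real n)"
    and g1: "\<And>j. j < k \<Longrightarrow> g j \<ge> 1"
    and g: "\<And>j. j < k \<Longrightarrow> real (g j) \<le> p * (if even j then a else b) / (16 * Suc k)"
    and small: "\<And>j. j < k \<Longrightarrow> p * (\<Prod>l<j. real (g l)) \<le> 1 / 2"
    and q: "0 \<le> q" "q \<le> 1 - (1 - p) ^ (\<Prod>j=1..<k. g j)" and N: "N \<le> q * g 0 / 4"
  shows "measure_pmf.prob (rbg m n p) {E. many_disjoint_paths m n E (Suc k) N x y}
    \<ge> 1 - k / (2 * p) * exp (- (p * m / (16 * Suc k))) - exp (- N)"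
proof -
  define L where "L = block_layers m n (Suc k) x y"
  have BL: "bip_layers m n (Suc k) (isl x) L"
    unfolding L_def by (rule bip_layers_block_layers[OF x])
  have cardL: "real (card (L (Suc j))) \<ge> (if even j then a else b) / (2 * Suc k)" if "j < k" for j
    using block_layers_card[of "Suc j" "Suc k" m n x y] that mn
    by (auto simp: L_def ab split: if_splits)
  have abm: "(if even j then a else b) \<ge> real m" for j :: nat using mn(2) by (simp add: ab)
  let ?D = "layer_edges edge_key L (Suc k)"
  have "1 - (\<Sum>j<k. (\<Prod>l<j. real (g l)) * exp (- (p * card (L (Suc j)) / 8))) - exp (- (q * g 0 / 4)) \<le>
      measure_pmf.prob (rand_edges ?D p)
        {E. \<exists>P. disjoint_layer_paths edge_key L (Suc k) E P \<and> q * g 0 / 4 \<le> card P}"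
  proof (rule prob_disjoint_layer_paths[where x = x and y = y])
    show "real (8 * g j) \<le> p * real (card (L (Suc j)))" if "j < k" for j
    proof -
      have "real (8 * g j) \<le> p * ((if even j then a else b) / (2 * Suc k))"
        using g[OF that] by (simp add: field_simps)
      also have "\<dots> \<le> p * real (card (L (Suc j)))"
        using cardL[OF that] p by (intro mult_left_mono) auto
      finally show ?thesis .
    qed
    show "L 0 = {x}" "L (Suc k) = {y}" by (auto simp: L_def block_layers_def)
  qed (use k p q g1 small bip_layers_finite[OF BL] bip_layers_inj[OF BL]
      bip_layers_edges_disjoint[OF BL] in auto)
  also have "\<dots> = measure_pmf.prob (rand_edges ({..<m} \<times> {..<n}) p)
        {E. \<exists>P. disjoint_layer_paths edge_key L (Suc k) E P \<and> q * g 0 / 4 \<le> card P}"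
    by (intro prob_rand_edges_subset[symmetric] local_disjoint_layer_paths bip_layers_edges[OF BL]) auto
  also have "\<dots> \<le> measure_pmf.prob (rbg m n p) {E. many_disjoint_paths m n E (Suc k) N x y}"
    unfolding rbg_def
  proof (intro measure_pmf.finite_measure_mono subsetI CollectI)
    fix E assume "E \<in> {E. \<exists>P. disjoint_layer_paths edge_key L (Suc k) E P \<and> q * g 0 / 4 \<le> card P}"
    then obtain P where "disjoint_layer_paths edge_key L (Suc k) E P" "N \<le> card P" using N by auto
    then show "many_disjoint_paths m n E (Suc k) N x y"
      by (rule many_disjoint_paths_of_layers[OF BL]) (use k in \<open>auto simp: L_def block_layers_def\<close>)
  qed auto
  finally have main: "1 - (\<Sum>j<k. (\<Prod>l<j. real (g l)) * exp (- (p * card (L (Suc j)) / 8))) - exp (- (q * g 0 / 4))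
    \<le> measure_pmf.prob (rbg m n p) {E. many_disjoint_paths m n E (Suc k) N x y}" .
  have "(\<Sum>j<k. (\<Prod>l<j. real (g l)) * exp (- (p * card (L (Suc j)) / 8))) \<le>
      (\<Sum>j<k. 1 / (2 * p) * exp (- (p * m / (16 * Suc k))))"
  proof (intro sum_mono mult_mono)
    fix j assume "j \<in> {..<k}"
    then have j: "j < k" by simp
    show "(\<Prod>l<j. real (g l)) \<le> 1 / (2 * p)" using small[OF j] p by (simp add: field_simps)
    have "real m / (2 * Suc k) \<le> card (L (Suc j))"
      using cardL[OF j] abm[of j] by (meson divide_right_mono of_nat_0_le_iff order_trans)
    then have "p * (real m / (2 * Suc k)) \<le> p * card (L (Suc j))"
      using p by (intro mult_left_mono) auto
    then have "p * m / (16 * Suc k) \<le> p * card (L (Suc j)) / 8" by (simp add: field_simps)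
    then show "exp (- (p * card (L (Suc j)) / 8)) \<le> exp (- (p * m / (16 * Suc k)))" by simp
  qed (use p in auto)
  also have "\<dots> = k / (2 * p) * exp (- (p * m / (16 * Suc k)))" by simp
  finally have sum: "(\<Sum>j<k. (\<Prod>l<j. real (g l)) * exp (- (p * card (L (Suc j)) / 8))) \<le>
      k / (2 * p) * exp (- (p * m / (16 * Suc k)))" .
  have "exp (- (q * g 0 / 4)) \<le> exp (- N)" using N by simp
  then show ?thesis using main sum by linarith
qed

section \<open>Numerical estimates\<close>

definition alt_prod :: "real \<Rightarrow> real \<Rightarrow> nat \<Rightarrow> real" where
  "alt_prod a b r = (\<Prod>j<r. if even j then a else b)"

lemma alt_prod_shift: "(\<Prod>j=1..<Suc r. if even j then a else b) = alt_prod b a r"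
  unfolding alt_prod_def lessThan_atLeast0 One_nat_def prod.shift_bounds_Suc_ivl
  by (intro prod.cong) auto

lemma prod_lessThan_Suc_ivl: "(\<Prod>j<Suc r. f j) = f 0 * (\<Prod>j=1..<Suc r. f j :: real)"
  by (simp add: lessThan_atLeast0 prod.atLeast_Suc_lessThan del: prod.lessThan_Suc)

text \<open>Both parts follow from (1 - p) ^ t \<le> exp (- p t) \<le> 1 / (1 + p t). The first
  regime serves paths of length d, the second those of length d + 1.\<close>

lemma one_minus_power_bounds:
  fixes p :: real
  assumes "0 \<le> p" "p \<le> 1"
  shows "p * t \<le> 1 \<Longrightarrow> p * t / 2 \<le> 1 - (1 - p) ^ t"
    and "1 \<le> p * t \<Longrightarrow> 1 / 2 \<le> 1 - (1 - p) ^ t"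
proof -
  have "(1 - p) ^ t \<le> exp (- p) ^ t"
    using assms exp_ge_add_one_self[of "- p"] by (intro power_mono) auto
  also have "\<dots> = exp (- (p * t))" by (simp add: mult.commute flip: exp_of_nat_mult)
  also have "\<dots> \<le> 1 / (1 + p * t)"
    unfolding exp_minus inverse_eq_divide
    using assms exp_ge_add_one_self[of "p * t"] by (intro divide_left_mono) (auto intro!: mult_pos_pos add_pos_nonneg)
  finally have *: "(1 - p) ^ t \<le> 1 / (1 + p * t)" .
  define u where "u = p * t"
  have u: "u \<ge> 0" using assms by (simp add: u_def)
  {
    assume "p * t \<le> 1"
    then have "0 \<le> u * (1 - u)" using u by (simp add: u_def)
    then have "1 / (1 + u) \<le> 1 - u / 2" using u by (simp add: field_simps)
    then show "p * t / 2 \<le> 1 - (1 - p) ^ t" using * by (simp add: u_def)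
  next
    assume "1 \<le> p * t"
    then have "1 / (1 + u) \<le> 1 / 2" using u by (simp add: u_def field_simps)
    then show "1 / 2 \<le> 1 - (1 - p) ^ t" using * by (simp add: u_def)
  }
qed

text \<open>Rounding down loses at most a factor 2, which turns 16 (d + 1) into the 32 (d + 1) of
  the later bounds.\<close>

lemma nat_floor_bounds:
  fixes c :: real
  assumes "c \<ge> 1"
  shows "c / 2 \<le> real (nat \<lfloor>c\<rfloor>)" and "real (nat \<lfloor>c\<rfloor>) \<le> c" and "nat \<lfloor>c\<rfloor> \<ge> 1"
proof -
  have 1: "1 \<le> \<lfloor>c\<rfloor>" using assms by simp
  then have 2: "real (nat \<lfloor>c\<rfloor>) = of_int \<lfloor>c\<rfloor>" by simp
  have "(1::real) \<le> of_int \<lfloor>c\<rfloor>" "c < of_int \<lfloor>c\<rfloor> + 1" using 1 by (simp, linarith)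
  then show "c / 2 \<le> real (nat \<lfloor>c\<rfloor>)" unfolding 2 by linarith
  show "real (nat \<lfloor>c\<rfloor>) \<le> c" unfolding 2 by (rule of_int_floor_le)
  show "nat \<lfloor>c\<rfloor> \<ge> 1" using 1 by linarith
qed

text \<open>For paths of length \<open>d\<close> every layer is used in full. For length \<open>d + 1\<close> this would make the
  last levels of the tree too large, and the root only gets \<open>G\<close> children.\<close>

lemma prob_many_disjoint_paths_pair:
  fixes d m n G :: nat and p N :: real
  assumes d: "d \<ge> 2" and mn: "6 * (d + 1) \<le> m" "m \<le> n" and p: "0 < p" "p \<le> 1"
    and G: "1 \<le> G" "16 * (d + 1) * G \<le> p * m"
    and I: "p * G * alt_prod (p * m) (p * n) (d - 2) \<le> 1 / 2"
           "p * G * alt_prod (p * n) (p * m) (d - 2) \<le> 1 / 2"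
    and II: "8 * (32 * (d + 1)) ^ (d - 1) * N \<le> p * alt_prod (p * m) (p * n) (d - 1)"
            "8 * (32 * (d + 1)) ^ (d - 1) * N \<le> p * alt_prod (p * n) (p * m) (d - 1)"
    and N: "1 \<le> N" "8 * N \<le> G"
    and x: "x \<in> bip_vertices m n" "y \<in> bip_vertices m n" "x \<noteq> y" "(isl x = isl y) = even l"
    and l: "l = d \<or> l = d + 1"
  shows "measure_pmf.prob (rbg m n p) {E. many_disjoint_paths m n E l N x y}
    \<ge> 1 - d / (2 * p) * exp (- (p * m / (16 * (d + 1)))) - exp (- N)"
proof -
  define a where "a = (if isl x then real n else real m)"
  define b where "b = (if isl x then real m else real n)"
  \<comment> \<open>The divisor of \<open>prob_many_disjoint_paths\<close> for k = d; it is larger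
    than the one for k = d - 1 and so serves both lengths.\<close>
  define K where "K = 16 * (real d + 1)"
  have K: "K > 0" by (simp add: K_def)
  define c where "c j = p * (if even j then a else b) / K" for j :: nat
  define g where "g j = nat \<lfloor>c j\<rfloor>" for j
  have ab: "a \<ge> m" "b \<ge> m" using mn(2) by (auto simp: a_def b_def)
  have I': "p * G * alt_prod (p * b) (p * a) (d - 2) \<le> 1 / 2" "p * G * alt_prod (p * a) (p * b) (d - 2) \<le> 1 / 2"
    using I by (auto simp: a_def b_def)
  have II': "8 * (2 * K) ^ (d - 1) * N \<le> p * alt_prod (p * a) (p * b) (d - 1)"
    "8 * (2 * K) ^ (d - 1) * N \<le> p * alt_prod (p * b) (p * a) (d - 1)"
    using II by (auto simp: a_def b_def K_def algebra_simps)
  have alt0: "alt_prod (p * b) (p * a) r \<ge> 0" "alt_prod (p * a) (p * b) r \<ge> 0" for r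
    using p ab by (auto simp: alt_prod_def intro!: prod_nonneg)
  have cm: "p * m / K \<le> c j" for j
    using ab p K by (auto simp: c_def intro!: divide_right_mono mult_left_mono)
  have "K * 1 \<le> K * real G" using G(1) K by (intro mult_left_mono) auto
  then have "K \<le> p * m" using G(2) by (simp add: K_def algebra_simps)
  then have "p * m / K \<ge> 1" using K by simp
  then have c1: "c j \<ge> 1" for j using cm[of j] by linarith
  have g: "c j / 2 \<le> g j" "g j \<le> c j" "g j \<ge> 1" for j
    using nat_floor_bounds[OF c1[of j]] by (auto simp: g_def)
  have cle: "c j \<le> (if even j then p * a else p * b)" for j
  proof -
    have "0 \<le> p * a" "0 \<le> p * b" using p ab by auto
    moreover have "K \<ge> 1" by (simp add: K_def)
    ultimately show ?thesis by (auto simp: c_def divide_le_eq mult_le_cancel_left1 algebra_simps)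
        (metis mult.commute mult_right_mono mult_1_right mult_1)+
  qed
  have gle: "real (g j) \<le> (if even j then p * a else p * b)" for j
    using g(2) cle by (rule order_trans)
  have c_eq: "c j / 2 = (if even j then p * a else p * b) / (2 * K)" for j
    by (simp add: c_def)
  have lower: "alt_prod (p * b) (p * a) r / (2 * K) ^ r \<le> (\<Prod>j=1..<Suc r. real (g j))" for r
  proof -
    have "alt_prod (p * b) (p * a) r / (2 * K) ^ r =
        (\<Prod>j=1..<Suc r. (if even j then p * a else p * b) / (2 * K))"
      unfolding prod_dividef alt_prod_shift by simp
    also have "\<dots> \<le> (\<Prod>j=1..<Suc r. real (g j))"
    proof (rule prod_mono)
      fix j
      show "0 \<le> (if even j then p * a else p * b) / (2 * K) \<and>
          (if even j then p * a else p * b) / (2 * K) \<le> real (g j)"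
        using g(1)[of j] c1[of j] unfolding c_eq[symmetric] by auto
    qed
    finally show ?thesis .
  qed
  have upper: "(\<Prod>j=1..<Suc r. real (g j)) \<le> alt_prod (p * b) (p * a) r" for r
    unfolding alt_prod_shift[symmetric] by (intro prod_mono conjI of_nat_0_le_iff gle)
  have dd: "Suc (d - 2) = d - 1" "Suc (d - 1) = d" using d by auto
  have expd: "exp (- (p * m / (16 * Suc k))) \<le> exp (- (p * m / (16 * (d + 1))))" if "k \<le> d" for k
    using that p by (auto intro!: divide_left_mono mult_left_mono)
  have fin: "1 - d / (2 * p) * exp (- (p * m / (16 * (d + 1)))) - exp (- N) \<le>
      1 - k / (2 * p) * exp (- (p * m / (16 * Suc k))) - exp (- N)" if "k \<le> d" for k
  proof -
    have "k / (2 * p) * exp (- (p * m / (16 * Suc k))) \<le> d / (2 * p) * exp (- (p * m / (16 * (d + 1))))"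
      using that p expd[OF that] by (intro mult_mono divide_right_mono) auto
    then show ?thesis by simp
  qed
  have cK: "c j \<le> p * (if even j then a else b) / (16 * Suc k)" if "k \<le> d" for j k
    unfolding c_def using that p ab K by (intro divide_left_mono) (auto simp: K_def)
  from l show ?thesis
  proof
    assume l: "l = d"
    have sl: "l = Suc (d - 1)" using l d by simp
    let ?t = "\<Prod>j=1..<d - 1. g j"
    let ?q = "p * ?t / 2"
    have t: "real ?t \<le> alt_prod (p * b) (p * a) (d - 2)"
      using upper[of "d - 2"] dd by simp
    have pt: "p * ?t \<le> 1"
    proof -
      have "p * ?t \<le> p * alt_prod (p * b) (p * a) (d - 2)"
        using t p by (intro mult_left_mono) auto
      also have "\<dots> \<le> p * G * alt_prod (p * b) (p * a) (d - 2)"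
        using G(1) p alt0 by (intro mult_right_mono) auto
      finally show ?thesis using I'(1) by linarith
    qed
    have small: "p * (\<Prod>i<j. real (g i)) \<le> 1 / 2" if "j < d - 1" for j
    proof -
      \<comment> \<open>All factors are at least 1, so the last level to be extended is the
        worst.\<close>
      have "(\<Prod>i<j. real (g i)) \<le> (\<Prod>i<d - 2. real (g i))"
        using that g(3) by (intro prod_mono2) auto
      also have "\<dots> \<le> alt_prod (p * a) (p * b) (d - 2)"
        unfolding alt_prod_def by (intro prod_mono conjI of_nat_0_le_iff gle)
      finally have "p * (\<Prod>i<j. real (g i)) \<le> p * alt_prod (p * a) (p * b) (d - 2)"
        using p by (intro mult_left_mono) auto
      also have "\<dots> \<le> p * G * alt_prod (p * a) (p * b) (d - 2)"
        using G(1) p alt0 by (intro mult_right_mono) auto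
      finally show ?thesis using I'(2) by linarith
    qed
    \<comment> \<open>The right side is p / 8 times the product of all d - 1 degrees, each at least
      its share of the full degree divided by 2 K. This is the origin of the 8 and of the power d -
      1 in \<open>II\<close>.\<close>
    have NN: "N \<le> ?q * g 0 / 4"
    proof -
      have "alt_prod (p * a) (p * b) (d - 1) / (2 * K) ^ (d - 1) =
          (\<Prod>j<d - 1. (if even j then p * a else p * b) / (2 * K))"
        unfolding prod_dividef alt_prod_def by simp
      also have "\<dots> \<le> (\<Prod>j<d - 1. real (g j))"
      proof (rule prod_mono)
        fix j
        show "0 \<le> (if even j then p * a else p * b) / (2 * K) \<and>
            (if even j then p * a else p * b) / (2 * K) \<le> real (g j)"
          using g(1)[of j] c1[of j] unfolding c_eq[symmetric] by auto
      qed
      also have "\<dots> = g 0 * ?t"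
        using prod_lessThan_Suc_ivl[of "\<lambda>j. real (g j)" "d - 2"] dd by simp
      finally have "p * (alt_prod (p * a) (p * b) (d - 1) / (2 * K) ^ (d - 1)) \<le> p * (g 0 * ?t)"
        using p by (intro mult_left_mono) auto
      moreover have "8 * N \<le> p * alt_prod (p * a) (p * b) (d - 1) / (2 * K) ^ (d - 1)"
        using II'(1) K by (simp add: pos_le_divide_eq algebra_simps)
      ultimately show ?thesis by (simp add: algebra_simps)
    qed
    have "1 - real (d - 1) / (2 * p) * exp (- (p * m / (16 * Suc (d - 1)))) - exp (- N) \<le>
        measure_pmf.prob (rbg m n p) {E. many_disjoint_paths m n E (Suc (d - 1)) N x y}"
    proof (rule prob_many_disjoint_paths[where g = g and q = ?q and a = a and b = b])
      show "0 \<le> ?q" using p by (simp add: prod_nonneg)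
      show "?q \<le> 1 - (1 - p) ^ ?t" by (rule one_minus_power_bounds(1)[OF less_imp_le[OF p(1)] p(2) pt])
      show "real (g j) \<le> p * (if even j then a else b) / real (16 * Suc (d - 1))" for j
        using g(2)[of j] cK[of "d - 1" j] by linarith
    qed (use x l sl d mn p g(3) small NN in \<open>auto simp: a_def b_def\<close>)
    then show ?thesis using fin[of "d - 1"] sl by simp
  next
    assume l: "l = d + 1"
    define g' where "g' j = (if j = 0 then G else g j)" for j
    have g'_prod: "(\<Prod>j=1..<r. g' j) = (\<Prod>j=1..<r. g j)" for r
      by (intro prod.cong) (auto simp: g'_def)
    let ?t = "\<Prod>j=1..<d. g j"
    \<comment> \<open>With one more level, \<open>II\<close> makes p t at least 8 N. So a branch is
      hit with probability at least 1/2, and 8 N branches are enough for N paths.\<close>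
    have pt: "1 \<le> p * ?t"
    proof -
      have "8 * N \<le> p * alt_prod (p * b) (p * a) (d - 1) / (2 * K) ^ (d - 1)"
        using II'(2) K by (simp add: pos_le_divide_eq algebra_simps)
      also have "\<dots> = p * (alt_prod (p * b) (p * a) (d - 1) / (2 * K) ^ (d - 1))" by simp
      also have "\<dots> \<le> p * (\<Prod>j=1..<d. real (g j))"
        using lower[of "d - 1"] dd p by (intro mult_left_mono) auto
      finally show ?thesis using N(1) by simp
    qed
    \<comment> \<open>At the last level only d - 2 full degrees remain beside the root degree
      \<open>G\<close>, for which \<open>I\<close> leaves room.\<close>
    have small: "p * (\<Prod>i<j. real (g' i)) \<le> 1 / 2" if "j < d" for j
    proof -
      have "(\<Prod>i<j. real (g' i)) \<le> (\<Prod>i<Suc (d - 2). real (g' i))"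
        using that d g(3) G(1) by (intro prod_mono2) (auto simp: g'_def)
      also have "\<dots> = G * (\<Prod>j=1..<Suc (d - 2). real (g' j))"
        unfolding prod_lessThan_Suc_ivl by (simp add: g'_def)
      also have "(\<Prod>j=1..<Suc (d - 2). real (g' j)) = (\<Prod>j=1..<Suc (d - 2). real (g j))"
        by (intro prod.cong) (auto simp: g'_def)
      also have "G * \<dots> \<le> G * alt_prod (p * b) (p * a) (d - 2)"
        by (intro mult_left_mono upper) auto
      finally have "p * (\<Prod>i<j. real (g' i)) \<le> p * (G * alt_prod (p * b) (p * a) (d - 2))"
        using p by (intro mult_left_mono) auto
      then show ?thesis using I'(1) by (simp add: mult.assoc)
    qed
    have "1 - real d / (2 * p) * exp (- (p * m / (16 * Suc d))) - exp (- N) \<le>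
        measure_pmf.prob (rbg m n p) {E. many_disjoint_paths m n E (Suc d) N x y}"
    proof (rule prob_many_disjoint_paths[where g = g' and q = "1 / 2" and a = a and b = b])
      show "1 / 2 \<le> 1 - (1 - p) ^ (\<Prod>j=1..<d. g' j)"
        unfolding g'_prod by (rule one_minus_power_bounds(2)[OF less_imp_le[OF p(1)] p(2) pt])
      show "real (g' j) \<le> p * (if even j then a else b) / real (16 * Suc d)" for j
      proof (cases "j = 0")
        case True
        have "real G \<le> p * m / K" using G(2) K by (simp add: K_def field_simps)
        then have "real G \<le> c 0" using cm[of 0] by linarith
        then show ?thesis using True by (simp add: g'_def c_def K_def algebra_simps)
      next
        case False
        then show ?thesis using g(2)[of j] cK[of d j] by (simp add: g'_def)
      qed
      show "1 \<le> g' j" for j using g(3) G(1) by (simp add: g'_def)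
      show "N \<le> 1 / 2 * real (g' 0) / 4" using N by (simp add: g'_def)
    qed (use x l d mn p small in \<open>auto simp: a_def b_def\<close>)
    then show ?thesis using fin[of d] l by simp
  qed
qed

section \<open>Union bound over the pairs and asymptotics\<close>

lemma prob_bip_connect:
  fixes d m n ks kd :: nat and p N \<eta> :: real
  assumes "m \<le> n" "0 \<le> \<eta>"
    and pair: "\<And>x y l. x \<in> bip_vertices m n \<Longrightarrow> y \<in> bip_vertices m n \<Longrightarrow> x \<noteq> y \<Longrightarrow>
      l \<in> {ks, kd} \<Longrightarrow> (isl x = isl y) = even l \<Longrightarrow>
      measure_pmf.prob (rbg m n p) {E. many_disjoint_paths m n E l N x y} \<ge> 1 - \<eta>"
    and par: "even ks" "odd kd"
  shows "measure_pmf.prob (rbg m n p) {E. bip_connect_prop m n E ks kd N} \<ge> 1 - 4 * real n ^ 2 * \<eta>"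
proof -
  let ?V = "bip_vertices m n"
  let ?S = "{z \<in> ?V \<times> ?V. fst z \<noteq> snd z}"
  let ?X = "\<lambda>z E. many_disjoint_paths m n E (if isl (fst z) = isl (snd z) then ks else kd) N (fst z) (snd z)"
  have "card ?V \<le> card (Inl ` {..<m} :: bvert set) + card (Inr ` {..<n} :: bvert set)"
    unfolding bip_vertices_def by (rule card_Un_le)
  also have "\<dots> \<le> 2 * n" using assms(1) by (simp add: card_image)
  finally have V: "card ?V \<le> 2 * n" .
  have "card ?S \<le> card (?V \<times> ?V)"
    by (intro card_mono finite_cartesian_product finite_bip_vertices) auto
  also have "\<dots> \<le> (2 * n) * (2 * n)" unfolding card_cartesian_product using V by (intro mult_mono) auto
  also have "\<dots> = 4 * n ^ 2" by (simp add: power2_eq_square)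
  finally have "real (card ?S) \<le> real (4 * n ^ 2)" by (rule of_nat_mono)
  then have S: "real (card ?S) * \<eta> \<le> 4 * real n ^ 2 * \<eta>" using assms(2) by (intro mult_right_mono) auto
  have "1 - 4 * real n ^ 2 * \<eta> \<le> 1 - (\<Sum>z\<in>?S. \<eta>)" using S by simp
  also have "\<dots> \<le> measure_pmf.prob (rbg m n p) {E. \<forall>z\<in>?S. ?X z E}"
  proof (rule prob_Ball_ge)
    show "finite ?S" using finite_bip_vertices by simp
    show "1 - \<eta> \<le> measure_pmf.prob (rbg m n p) {E. ?X z E}" if "z \<in> ?S" for z
      using that par by (intro pair) auto
  qed
  also have "{E. \<forall>z\<in>?S. ?X z E} = {E. bip_connect_prop m n E ks kd N}"
    by (auto simp: bip_connect_prop_def)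
  finally show ?thesis .
qed

lemma log2_ge_ln: "1 \<le> x \<Longrightarrow> ln x \<le> log 2 x"
  using ln_2_less_1 by (simp add: log_def pos_le_divide_eq mult_left_le)

text \<open>With \<open>ln\<close> in place of \<open>log 2\<close>, the first term is below every
  power of n and the second is n ^ (- 10), so the left side is O(n ^ (- 8)). Going back to the
  larger \<open>log 2 n\<close> only decreases both exponentials.\<close>

lemma union_bound_asymp:
  fixes D H N0 :: real
  assumes "D > 0" "H > 0" "N0 \<ge> 10"
  shows "\<forall>\<^sub>F n::nat in at_top.
    4 * real n ^ 2 * (D * real n * exp (- ((log 2 n) ^ 4 / H)) + exp (- (N0 * log 2 n))) \<le> n powr (- 1)"
proof -
  have "\<forall>\<^sub>F n::nat in at_top.
      4 * real n ^ 2 * (D * real n * exp (- ((ln (real n)) ^ 4 / H)) + exp (- (10 * ln (real n)))) \<le> real n powr (- 1)"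
    using assms(1,2) by real_asymp
  then show ?thesis
    using eventually_ge_at_top[of 1]
  proof eventually_elim
    case (elim n)
    have ln: "0 \<le> ln n" "ln n \<le> log 2 n" using elim by (auto intro: log2_ge_ln)
    then have "10 * ln n \<le> N0 * log 2 n" using assms(3) by (intro mult_mono) auto
    then have 1: "exp (- (N0 * log 2 n)) \<le> exp (- (10 * ln n))" by simp
    have "ln n ^ 4 / H \<le> log 2 n ^ 4 / H"
      using ln assms(2) by (intro divide_right_mono power_mono) auto
    then have 2: "D * n * exp (- ((log 2 n) ^ 4 / H)) \<le> D * n * exp (- ((ln n) ^ 4 / H))"
      using assms(1) by (intro mult_left_mono) auto
    have "4 * real n ^ 2 * (D * n * exp (- ((log 2 n) ^ 4 / H)) + exp (- (N0 * log 2 n))) \<le>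
        4 * real n ^ 2 * (D * n * exp (- ((ln n) ^ 4 / H)) + exp (- (10 * ln n)))"
      by (rule mult_left_mono[OF add_mono[OF 2 1]]) simp
    then show ?case using elim by linarith
  qed
qed

lemma alt_prod_ge_1: "a \<ge> 1 \<Longrightarrow> b \<ge> 1 \<Longrightarrow> alt_prod a b r \<ge> 1"
  unfolding alt_prod_def by (intro prod_ge_1) auto

text \<open>The fourth power of log n pays for a root degree of (log n)^2, for the log n on the
  right of \<open>I\<close>, and for one spare log n that absorbs the constants.\<close>

lemma connect_eventually:
  fixes d ks kd :: nat and K N0 :: real and m :: "nat \<Rightarrow> nat" and p :: "nat \<Rightarrow> real"
  assumes d: "d \<ge> 2" and k: "even ks" "odd kd" "{ks, kd} = {d, d + 1}" and K: "K > 0" and N0: "N0 \<ge> 10"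
    and ev: "\<forall>\<^sub>F n in at_top. m n \<le> n \<and> 0 < p n \<and> (log 2 n) ^ 4 \<le> p n * m n"
    and I: "\<forall>\<^sub>F n in at_top. p n * alt_prod (p n * m n) (p n * n) (d - 2) \<le> K * log 2 n / (p n * m n) \<and>
           p n * alt_prod (p n * n) (p n * m n) (d - 2) \<le> K * log 2 n / (p n * m n)"
    and II: "\<forall>\<^sub>F n in at_top.
        8 * (32 * (d + 1)) ^ (d - 1) * (N0 * log 2 n) \<le> p n * alt_prod (p n * m n) (p n * n) (d - 1) \<and>
        8 * (32 * (d + 1)) ^ (d - 1) * (N0 * log 2 n) \<le> p n * alt_prod (p n * n) (p n * m n) (d - 1)"
  shows "\<forall>\<^sub>F n in at_top. measure_pmf.prob (rbg (m n) n (p n))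
      {E. bip_connect_prop (m n) n E ks kd (N0 * log 2 n)} \<ge> 1 - n powr (- 1)"
proof -
  define H where "H = 16 * (real d + 1)"
  have H: "H > 0" by (simp add: H_def)
  have lim: "filterlim (\<lambda>n::nat. log 2 n) at_top at_top" unfolding log_def by real_asymp
  \<comment> \<open>With L = log n, \<open>H\<close> gives 16 (d + 1) G \<le> L^3 and 6 (d + 1)
    \<le> M, \<open>2 * K\<close> gives K / L \<le> 1/2, and \<open>16 * N0\<close> gives 8 N \<le>
    L^2 / 2 \<le> G.\<close>
  have "\<forall>\<^sub>F n::nat in at_top. log 2 n \<ge> max 1 (max H (max (2 * K) (16 * N0)))"
    using lim unfolding filterlim_at_top by blast
  moreover have "\<forall>\<^sub>F n::nat in at_top.
      4 * real n ^ 2 * (real d * real n * exp (- ((log 2 n) ^ 4 / H)) + exp (- (N0 * log 2 n))) \<le> n powr (- 1)"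
    using d H N0 by (intro union_bound_asymp) auto
  ultimately show ?thesis
    using ev I II
  proof eventually_elim
    case (elim n)
    define L where "L = log 2 n"
    define P where "P = p n"
    define M where "M = m n"
    define N where "N = N0 * L"
    define G where "G = nat \<lfloor>L ^ 2\<rfloor>"
    define \<eta> where "\<eta> = real d * real n * exp (- (L ^ 4 / H)) + exp (- N)"
    have L: "L \<ge> 1" "L \<ge> H" "L \<ge> 2 * K" "L \<ge> 16 * N0" using elim(1) by (auto simp: L_def)
    have Pp: "0 < P" "M \<le> n" and PM: "L ^ 4 \<le> P * M" using elim(3) by (auto simp: L_def P_def M_def)
    have L4: "L * L ^ 2 \<le> L ^ 4" "L \<le> L ^ 4" "1 \<le> L ^ 4" "1 \<le> L ^ 2"
      using L(1) power_increasing[of 3 4 L] power_increasing[of 1 4 L] one_le_power[of L 4] one_le_power[of L 2]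
      by (auto simp flip: power_Suc)
    have Pn: "P * M \<le> P * n" using Pp by (intro mult_left_mono) auto
    have PM1: "1 \<le> P * M" "1 \<le> P * n" using PM L4 Pn by auto
    have "K * L / (P * M) \<le> K * L / L ^ 4"
      using K L PM L4 by (intro divide_left_mono) (auto intro!: mult_pos_pos)
    then have KL: "K * L / (P * M) * L ^ 2 \<le> K * L / L ^ 4 * L ^ 2"
      by (intro mult_right_mono) auto
    also have "\<dots> = K / L" using L(1) by (simp add: field_simps power2_eq_square eval_nat_numeral)
    also have "\<dots> \<le> 1 / 2" using L by (simp add: field_simps)
    finally have KL: "K * L / (P * M) * L ^ 2 \<le> 1 / 2" .
    have I: "P * alt_prod (P * M) (P * n) (d - 2) \<le> K * L / (P * M)"
      "P * alt_prod (P * n) (P * M) (d - 2) \<le> K * L / (P * M)"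
      using elim(4) by (auto simp: L_def P_def M_def)
    have G: "L ^ 2 / 2 \<le> G" "G \<le> L ^ 2" "1 \<le> G"
      using nat_floor_bounds[OF L4(4)] by (auto simp: G_def)
    have I': "P * G * A \<le> 1 / 2" if "P * A \<le> K * L / (P * M)" for A
    proof -
      have "P * G * A = P * A * G" by simp
      also have "\<dots> \<le> K * L / (P * M) * G" using that by (intro mult_right_mono) auto
      also have "\<dots> \<le> K * L / (P * M) * L ^ 2"
        using G(2) K L Pp by (intro mult_left_mono divide_nonneg_nonneg mult_nonneg_nonneg) auto
      finally show ?thesis using KL by linarith
    qed
    \<comment> \<open>\<open>I\<close> already forces this: P times two factors that are at least 1
      is at most 1/2.\<close>
    have P1: "P \<le> 1"
    proof -
      have "1 * 1 \<le> G * alt_prod (P * M) (P * n) (d - 2)"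
        using G(3) alt_prod_ge_1[OF PM1, of "d - 2"] by (intro mult_mono) auto
      then have "P * 1 \<le> P * (G * alt_prod (P * M) (P * n) (d - 2))"
        using Pp by (intro mult_left_mono) auto
      then have "P \<le> P * G * alt_prod (P * M) (P * n) (d - 2)" by (simp add: mult.assoc)
      then show ?thesis using I'[OF I(1)] by linarith
    qed
    have "H * G \<le> L * L ^ 2" using L G H by (intro mult_mono) auto
    then have HG: "16 * (d + 1) * G \<le> P * M" using L4 PM by (simp add: H_def algebra_simps)
    have "P * M \<le> 1 * real M" using P1 by (intro mult_right_mono) auto
    then have "H \<le> real M" using PM L4 L by linarith
    then have "real (6 * (d + 1)) \<le> real M" by (simp add: H_def)
    then have M: "6 * (d + 1) \<le> M" by (simp only: of_nat_le_iff)
    have "1 * 1 \<le> N0 * L" using N0 L by (intro mult_mono) auto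
    then have N: "1 \<le> N" by (simp add: N_def)
    have "16 * N0 * L \<le> L * L" using L by (intro mult_right_mono) auto
    then have NG: "8 * N \<le> G" using G(1) by (simp add: N_def power2_eq_square)
    have eta: "d / (2 * P) * exp (- (P * M / (16 * (d + 1)))) + exp (- N) \<le> \<eta>"
    proof -
      \<comment> \<open>P n \<ge> P M \<ge> 1 bounds the prefactor d / (2 P) by d n, the form in
        \<open>union_bound_asymp\<close>.\<close>
      have "1 / P \<le> n" using PM1 Pp by (simp add: field_simps)
      then have "d * (1 / P) \<le> real d * real n" by (intro mult_left_mono) auto
      moreover have "d / (2 * P) \<le> d * (1 / P)" using Pp by (simp add: field_simps)
      ultimately have 1: "d / (2 * P) \<le> real d * real n" by linarith
      have "L ^ 4 / H \<le> P * M / H" using PM H by (intro divide_right_mono) auto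
      moreover have "P * M / H = P * M / (16 * (d + 1))" by (simp add: H_def)
      ultimately have "exp (- (P * M / (16 * (d + 1)))) \<le> exp (- (L ^ 4 / H))" by simp
      with 1 show ?thesis unfolding \<eta>_def by (intro add_right_mono mult_mono) auto
    qed
    have "measure_pmf.prob (rbg M n P) {E. bip_connect_prop M n E ks kd N} \<ge> 1 - 4 * real n ^ 2 * \<eta>"
    proof (rule prob_bip_connect)
      show "0 \<le> \<eta>" by (simp add: \<eta>_def)
      fix x y l assume xy: "x \<in> bip_vertices M n" "y \<in> bip_vertices M n" "x \<noteq> y"
        "l \<in> {ks, kd}" "(isl x = isl y) = even l"
      have "1 - d / (2 * P) * exp (- (P * M / (16 * (d + 1)))) - exp (- N) \<le>
          measure_pmf.prob (rbg M n P) {E. many_disjoint_paths M n E l N x y}"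
      proof (rule prob_many_disjoint_paths_pair[where G = G])
        show "8 * (32 * (d + 1)) ^ (d - 1) * N \<le> P * alt_prod (P * M) (P * n) (d - 1)"
          "8 * (32 * (d + 1)) ^ (d - 1) * N \<le> P * alt_prod (P * n) (P * M) (d - 1)"
          using elim(5) by (auto simp: L_def P_def M_def N_def)
        show "l = d \<or> l = d + 1" using xy(4) k(3) by blast
      qed (fact d M Pp P1 G(3) HG I'[OF I(1)] I'[OF I(2)] N NG xy)+
      then show "1 - \<eta> \<le> measure_pmf.prob (rbg M n P) {E. many_disjoint_paths M n E l N x y}"
        using eta by linarith
    qed (use Pp k in auto)
    moreover have "4 * real n ^ 2 * \<eta> \<le> n powr (- 1)"
      using elim(2) by (simp add: \<eta>_def L_def N_def)
    ultimately show ?case by (simp add: L_def M_def P_def N_def)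
  qed
qed

section \<open>Walk counts for the given densities\<close>

lemma alt_prod_even: "alt_prod a b (2 * r) = (a * b) ^ r"
  by (induction r) (auto simp: alt_prod_def)

lemma alt_prod_odd: "alt_prod a b (Suc (2 * r)) = a * (a * b) ^ r"
  using alt_prod_even[of a b r] by (simp add: alt_prod_def)

lemma powr_frac_power: "0 < x \<Longrightarrow> 0 < d \<Longrightarrow> (x powr (a / real d)) ^ d = x powr a"
  by (simp add: powr_powr flip: powr_realpow)

text \<open>Of the d factors \<open>C\<close>, one absorbs \<open>2 ^ (10 * d) * c0\<close> and each
  other absorbs 256 (d + 1) \<le> 2 ^ (8 + d). The leading 8 is spread over these as 8 \<le> 8 ^ (d
  - 1), by d \<ge> 2.\<close>

lemma constant_bound:
  fixes c0 C :: real
  assumes "d \<ge> 2" "c0 \<ge> 1" "C \<ge> 2 ^ (10 * d) * c0"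
  shows "8 * (32 * (real d + 1)) ^ (d - 1) * (2 ^ (10 * d) * c0) \<le> C ^ d"
proof -
  have C0: "0 \<le> C" using assms(2) by (intro order_trans[OF _ assms(3)]) auto
  have "8 ^ 1 \<le> (8::real) ^ (d - 1)" using assms(1) by (intro power_increasing) auto
  then have "8 * (32 * (real d + 1)) ^ (d - 1) \<le> 8 ^ (d - 1) * (32 * (real d + 1)) ^ (d - 1)"
    by (intro mult_right_mono) auto
  also have "\<dots> = (256 * (real d + 1)) ^ (d - 1)" by (simp add: power_mult_distrib[symmetric])
  also have "\<dots> \<le> (2 ^ (10 * d)) ^ (d - 1)"
  proof (rule power_mono)
    have "Suc d \<le> 2 ^ d" by (induction d) auto
    then have "real d + 1 \<le> 2 ^ d" by (metis of_nat_Suc of_nat_le_iff of_nat_numeral of_nat_power add.commute)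
    then have "256 * (real d + 1) \<le> 2 ^ 8 * 2 ^ d" by simp
    also have "\<dots> = (2::real) ^ (8 + d)" by (simp add: power_add)
    also have "\<dots> \<le> 2 ^ (10 * d)" using assms(1) by (intro power_increasing) auto
    finally show "256 * (real d + 1) \<le> 2 ^ (10 * d)" .
  qed auto
  also have "\<dots> \<le> C ^ (d - 1)"
  proof (rule power_mono)
    have "(2::real) ^ (10 * d) * 1 \<le> 2 ^ (10 * d) * c0" using assms(2) by (intro mult_left_mono) auto
    then show "2 ^ (10 * d) \<le> C" using assms(3) by linarith
  qed auto
  finally have "8 * (32 * (real d + 1)) ^ (d - 1) * (2 ^ (10 * d) * c0) \<le> C ^ (d - 1) * C"
    using assms(2,3) C0 by (intro mult_mono) auto
  also have "\<dots> = C ^ d" using assms(1) by (metis power_minus_mult zero_less_numeral less_le_trans)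
  finally show ?thesis .
qed

text \<open>The density is normalised so that P ^ d (M x) ^ ((d - 1) / 2) = C ^ d log (M x). As d -
  1 is even, both orders of the alternating product give this value. Dropping one vertex divides it
  by P x or by P M, and the smaller P M yields the common bound. The 2 comes from log (M x) \<le> 2
  log x.\<close>

lemma odd_case_bounds:
  fixes C M x :: real
  assumes d: "d = Suc (2 * Suc r)" and C: "C \<ge> 1" and M: "1 \<le> M" "M \<le> x" and x: "2 \<le> x"
    and P: "P = C * (log 2 (M * x) powr (1 / real d) /
      (M powr ((real d - 1) / (2 * real d)) * x powr ((real d - 1) / (2 * real d))))"
  shows "0 < P"
    and "C ^ d * log 2 x \<le> P * alt_prod (P * M) (P * x) (d - 1)"
    and "C ^ d * log 2 x \<le> P * alt_prod (P * x) (P * M) (d - 1)"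
    and "P * alt_prod (P * M) (P * x) (d - 2) \<le> 2 * C ^ d * log 2 x / (P * M)"
    and "P * alt_prod (P * x) (P * M) (d - 2) \<le> 2 * C ^ d * log 2 x / (P * M)"
proof -
  define l where "l = log 2 (M * x)"
  have Mx: "x \<le> M * x" "M * x \<le> x * x" using M x by (auto intro: mult_right_mono)
  have "log 2 x \<le> l" using Mx x by (simp add: l_def)
  moreover have "l \<le> log 2 (x * x)" using Mx x M by (simp add: l_def)
  then have "l \<le> 2 * log 2 x" using x by (simp add: log_mult)
  moreover have "1 \<le> log 2 x" using x by simp
  ultimately have l: "log 2 x \<le> l" "l \<le> 2 * log 2 x" "0 < l" by auto
  have d0: "d > 0" using d by simp
  \<comment> \<open>The exponents become multiples of 1 / d, so that the d-th power of
    \<open>P\<close> has natural exponents.\<close>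
  have e: "(real d - 1) / (2 * real d) = real (Suc r) / real d" using d by (simp add: field_simps)
  have "log 2 (M * x) \<noteq> 0" using l(3) unfolding l_def by (metis less_irrefl)
  then show Ppos: "0 < P" unfolding P e using C M x by (auto intro!: divide_pos_pos mult_pos_pos)
  have "P ^ d = C ^ d * l / (M ^ Suc r * x ^ Suc r)"
    unfolding P e power_mult_distrib power_divide using M x l d0
    by (simp add: powr_frac_power powr_realpow del: power_Suc of_nat_Suc flip: l_def)
  then have Pd: "P ^ d * (M * x) ^ Suc r = C ^ d * l"
    using M x by (simp add: power_mult_distrib del: power_Suc)
  have full: "P * ((P * M) * (P * x)) ^ Suc r = C ^ d * l"
  proof -
    have "P * ((P * M) * (P * x)) ^ Suc r = P * (P ^ 2) ^ Suc r * (M * x) ^ Suc r"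
      by (simp add: power_mult_distrib power2_eq_square algebra_simps)
    also have "P * (P ^ 2) ^ Suc r = P ^ d" unfolding d power_mult[symmetric] by simp
    also note Pd
    finally show ?thesis .
  qed
  have Cd: "C ^ d \<ge> 0" using C by simp
  have d1: "d - 1 = 2 * Suc r" "d - 2 = Suc (2 * r)" using d by auto
  have cl: "C ^ d * log 2 x \<le> C ^ d * l" "C ^ d * l \<le> C ^ d * (2 * log 2 x)"
    using l Cd by (auto intro!: mult_left_mono)
  show "C ^ d * log 2 x \<le> P * alt_prod (P * M) (P * x) (d - 1)"
    unfolding d1 alt_prod_even full by (rule cl)
  show "C ^ d * log 2 x \<le> P * alt_prod (P * x) (P * M) (d - 1)"
    unfolding d1 alt_prod_even mult.commute[of "P * x"] full by (rule cl)
  have PM: "0 < P * M" "0 < P * x" "P * M \<le> P * x" using Ppos M x by auto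
  have "P * (P * M * ((P * M) * (P * x)) ^ r) * (P * x) = C ^ d * l"
    unfolding full[symmetric] by (simp add: algebra_simps)
  then have "P * (P * M * ((P * M) * (P * x)) ^ r) = C ^ d * l / (P * x)"
    using PM(2) by (metis nonzero_eq_divide_eq less_irrefl)
  also have "\<dots> \<le> C ^ d * (2 * log 2 x) / (P * M)" using cl PM l C by (intro frac_le) auto
  finally show "P * alt_prod (P * M) (P * x) (d - 2) \<le> 2 * C ^ d * log 2 x / (P * M)"
    unfolding d1 alt_prod_odd by (simp add: mult.assoc mult.left_commute)
  have "P * (P * x * ((P * x) * (P * M)) ^ r) * (P * M) = C ^ d * l"
    unfolding full[symmetric] mult.commute[of "P * M" "P * x"] by (simp add: algebra_simps)
  then have "P * (P * x * ((P * x) * (P * M)) ^ r) = C ^ d * l / (P * M)"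
    using PM(1) by (metis nonzero_eq_divide_eq less_irrefl)
  also have "\<dots> \<le> C ^ d * (2 * log 2 x) / (P * M)" using cl PM l C by (intro frac_le) auto
  finally show "P * alt_prod (P * x) (P * M) (d - 2) \<le> 2 * C ^ d * log 2 x / (P * M)"
    unfolding d1 alt_prod_odd by (simp add: mult.assoc mult.left_commute)
qed

text \<open>Now d - 1 is odd and the two orders differ. One more factor P M than P x gives exactly C
  ^ d log x, and the other order is larger by x / M \<ge> 1. The smaller count belongs to two end
  points in V, whose paths of length d have one more inner vertex in U than in V; it dictates the
  density.\<close>

lemma even_case_bounds:
  fixes C M x :: real
  assumes d: "d = 2 * Suc r" and C: "C \<ge> 1" and M: "1 \<le> M" "M \<le> x" and x: "2 \<le> x"
    and P: "P = C * (log 2 x powr (1 / real d) /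
      (M powr (1 / 2) * x powr ((real d - 2) / (2 * real d))))"
  shows "0 < P"
    and "C ^ d * log 2 x \<le> P * alt_prod (P * M) (P * x) (d - 1)"
    and "C ^ d * log 2 x \<le> P * alt_prod (P * x) (P * M) (d - 1)"
    and "P * alt_prod (P * M) (P * x) (d - 2) \<le> 2 * C ^ d * log 2 x / (P * M)"
    and "P * alt_prod (P * x) (P * M) (d - 2) \<le> 2 * C ^ d * log 2 x / (P * M)"
proof -
  define l where "l = log 2 x"
  have l: "1 \<le> l" using x by (simp add: l_def)
  have d0: "d > 0" using d by simp
  have e: "(real d - 2) / (2 * real d) = real r / real d" "1 / 2 = real (Suc r) / real d"
    using d by (simp_all add: field_simps)
  have "log 2 x \<noteq> 0" using l unfolding l_def by (metis not_one_le_zero)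
  then show Ppos: "0 < P" unfolding P using C M x by (auto intro!: divide_pos_pos mult_pos_pos)
  have "P ^ d = C ^ d * l / (M ^ Suc r * x ^ r)"
    unfolding P e power_mult_distrib power_divide using M x l d0
    by (simp add: powr_frac_power powr_realpow del: power_Suc of_nat_Suc flip: l_def)
  then have Pd: "P ^ d * (M ^ Suc r * x ^ r) = C ^ d * l"
    using M x by (simp del: power_Suc)
  have full: "P * (P * M * ((P * M) * (P * x)) ^ r) = C ^ d * l"
  proof -
    have "P * (P * M * ((P * M) * (P * x)) ^ r) = P ^ 2 * (P ^ 2) ^ r * (M ^ Suc r * x ^ r)"
      by (simp add: power_mult_distrib power2_eq_square algebra_simps)
    also have "P ^ 2 * (P ^ 2) ^ r = P ^ d" unfolding d power_mult power_Suc ..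
    also note Pd
    finally show ?thesis .
  qed
  have d1: "d - 1 = Suc (2 * r)" "d - 2 = 2 * r" using d by auto
  have PM: "0 < P * M" "0 < P * x" "P * M \<le> P * x" using Ppos M x by auto
  show "C ^ d * log 2 x \<le> P * alt_prod (P * M) (P * x) (d - 1)"
    unfolding d1 alt_prod_odd full by (simp add: l_def)
  have "P * (P * M * ((P * M) * (P * x)) ^ r) \<le> P * (P * x * ((P * M) * (P * x)) ^ r)"
    using PM Ppos M x by (intro mult_left_mono mult_right_mono zero_le_power mult_nonneg_nonneg) auto
  then show "C ^ d * log 2 x \<le> P * alt_prod (P * x) (P * M) (d - 1)"
    unfolding d1 alt_prod_odd full by (simp add: l_def mult.commute[of "P * x" "P * M"])
  have "P * ((P * M) * (P * x)) ^ r * (P * M) = C ^ d * l"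
    unfolding full[symmetric] by (simp add: algebra_simps)
  then have "P * ((P * M) * (P * x)) ^ r = C ^ d * l / (P * M)"
    using PM(1) by (metis nonzero_eq_divide_eq less_irrefl)
  also have "\<dots> \<le> 2 * C ^ d * log 2 x / (P * M)"
    using PM(1) C l unfolding l_def by (intro divide_right_mono mult_right_mono) auto
  finally have last: "P * ((P * M) * (P * x)) ^ r \<le> 2 * C ^ d * log 2 x / (P * M)" .
  show "P * alt_prod (P * M) (P * x) (d - 2) \<le> 2 * C ^ d * log 2 x / (P * M)"
    unfolding d1 alt_prod_even by (rule last)
  show "P * alt_prod (P * x) (P * M) (d - 2) \<le> 2 * C ^ d * log 2 x / (P * M)"
    unfolding d1 alt_prod_even mult.commute[of "P * x" "P * M"] by (rule last)
qed

text \<open>Both parities of d enter here, with K = 2 C ^ d in \<open>connect_eventually\<close>;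
  the exponent obtained is \<delta> = 1.\<close>

lemma connect_eventually_of_bounds:
  fixes d ks kd :: nat and C N0 :: real and m :: "nat \<Rightarrow> nat" and P :: "nat \<Rightarrow> real"
  assumes d: "d \<ge> 2" and k: "even ks" "odd kd" "{ks, kd} = {d, d + 1}" and N0: "N0 \<ge> 10"
    and C: "C \<ge> 1" "8 * (32 * (real d + 1)) ^ (d - 1) * N0 \<le> C ^ d"
    and ev: "\<forall>\<^sub>F n in at_top. 1 \<le> m n \<and> m n \<le> n \<and> (log 2 n) ^ 4 \<le> P n * m n"
    and bounds: "\<And>n. 1 \<le> m n \<Longrightarrow> m n \<le> n \<Longrightarrow> 2 \<le> n \<Longrightarrow>
      0 < P n \<and>
      C ^ d * log 2 n \<le> P n * alt_prod (P n * m n) (P n * n) (d - 1) \<and>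
      C ^ d * log 2 n \<le> P n * alt_prod (P n * n) (P n * m n) (d - 1) \<and>
      P n * alt_prod (P n * m n) (P n * n) (d - 2) \<le> 2 * C ^ d * log 2 n / (P n * m n) \<and>
      P n * alt_prod (P n * n) (P n * m n) (d - 2) \<le> 2 * C ^ d * log 2 n / (P n * m n)"
  shows "\<exists>\<delta>>0. \<forall>\<^sub>F n in at_top. measure_pmf.prob (rbg (m n) n (P n))
      {E. bip_connect_prop (m n) n E ks kd (N0 * log 2 n)} \<ge> 1 - n powr (- \<delta>)"
proof (intro exI[of _ "1::real"] conjI connect_eventually[OF d k _ N0])
  have ev2: "\<forall>\<^sub>F n in at_top. 1 \<le> m n \<and> m n \<le> n \<and> (log 2 n) ^ 4 \<le> P n * m n \<and> 2 \<le> n"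
    using ev eventually_ge_at_top[of 2] by eventually_elim simp
  show "0 < 2 * C ^ d" using C by simp
  show "\<forall>\<^sub>F n in at_top. m n \<le> n \<and> 0 < P n \<and> (log 2 n) ^ 4 \<le> P n * m n"
    using ev2 by eventually_elim (use bounds in blast)
  show "\<forall>\<^sub>F n in at_top.
      P n * alt_prod (P n * m n) (P n * n) (d - 2) \<le> 2 * C ^ d * log 2 n / (P n * m n) \<and>
      P n * alt_prod (P n * n) (P n * m n) (d - 2) \<le> 2 * C ^ d * log 2 n / (P n * m n)"
    using ev2 by eventually_elim (use bounds in blast)
  show "\<forall>\<^sub>F n in at_top.
      8 * (32 * (d + 1)) ^ (d - 1) * (N0 * log 2 n) \<le> P n * alt_prod (P n * m n) (P n * n) (d - 1) \<and>
      8 * (32 * (d + 1)) ^ (d - 1) * (N0 * log 2 n) \<le> P n * alt_prod (P n * n) (P n * m n) (d - 1)"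
    using ev2
  proof eventually_elim
    case (elim n)
    have "8 * (32 * (real d + 1)) ^ (d - 1) * N0 * log 2 n \<le> C ^ d * log 2 n"
      using C(2) elim by (intro mult_right_mono) auto
    moreover have "real (8 * (32 * (d + 1)) ^ (d - 1)) * (N0 * log 2 n) =
        8 * (32 * (real d + 1)) ^ (d - 1) * N0 * log 2 n"
      by (simp add: mult.assoc add.commute distrib_left)
    ultimately show ?case using bounds[of n] elim by linarith
  qed
qed simp

text \<open>M = 0 would make \<open>M powr s\<close> vanish, against log n \<ge> 1. So p is positive
  and cancels in \<open>le\<close>, and M \<ge> 1 gives M powr s \<le> M. The exponent s is 1 for
  odd d and 1 - \<epsilon> for even d.\<close>

lemma part_sizes:
  fixes M p s c :: real and n :: nat
  assumes le: "p * M powr s \<le> p * real n powr s" and L: "(log 2 n) ^ 4 \<le> p * M powr s"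
    and "n \<ge> 2" "M = real k" "0 < s" "s \<le> 1" "c \<ge> 1"
  shows "1 \<le> k \<and> k \<le> n \<and> (log 2 n) ^ 4 \<le> c * p * M"
proof -
  have "log 2 n \<ge> 1" using assms(3) by simp
  then have pos: "0 < p * M powr s" using L by (smt (verit) one_le_power)
  then have "M \<noteq> 0" by auto
  then have k: "1 \<le> k" "1 \<le> M" using assms(4) by auto
  have p: "0 < p" using pos by (simp add: zero_less_mult_iff)
  have "M powr s \<le> real n powr s" using le p by simp
  then have "k \<le> n" using assms(4,5) k powr_less_mono2[of s "real n" M] by (meson linorder_not_le of_nat_0_le_iff of_nat_less_iff)
  moreover have "M powr s \<le> M powr 1" using k assms(6) by (intro powr_mono) auto
  then have "p * M powr s \<le> p * M" using p k by simp
  moreover have "1 * (p * M) \<le> c * (p * M)" using p k assms(7) by (intro mult_right_mono) auto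
  ultimately show ?thesis using L k by simp
qed

theorem theorem3:
  fixes d :: nat and c0 \<epsilon> :: real and m :: "nat \<Rightarrow> nat"
  assumes "d \<ge> 2" and "c0 \<ge> 1"
  shows
   "(odd d \<longrightarrow>
      (let C1 = 2 ^ (10 * d) * c0;
           p1 = (\<lambda>n::nat. log 2 (real (m n) * real n) powr (1 / real d) /
                   (real (m n) powr ((real d - 1) / (2 * real d)) *
                    real n powr ((real d - 1) / (2 * real d))))
       in (\<forall>\<^sub>F n in at_top. p1 n * real n \<ge> p1 n * real (m n) \<and>
                            p1 n * real (m n) \<ge> (log 2 (real n)) ^ 4) \<longrightarrow>
          (\<exists>\<delta>>0. \<forall>\<^sub>F n in at_top.
              measure_pmf.prob (rbg (m n) n (C1 * p1 n))
                {E. bip_connect_prop (m n) n E (d + 1) d (2 ^ (10 * d) * c0 * log 2 (real n))}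
              \<ge> 1 - real n powr (- \<delta>)))) \<and>
    (even d \<and> 0 < \<epsilon> \<and> \<epsilon> < 1 \<longrightarrow>
      (let C2 = 2 ^ (10 * d) * c0 / \<epsilon>;
           p2 = (\<lambda>n::nat. log 2 (real n) powr (1 / real d) /
                   (real (m n) powr (1 / 2) *
                    real n powr ((real d - 2) / (2 * real d))))
       in (\<forall>\<^sub>F n in at_top. p2 n * real n powr (1 - \<epsilon>) \<ge> p2 n * real (m n) powr (1 - \<epsilon>) \<and>
                            p2 n * real (m n) powr (1 - \<epsilon>) \<ge> (log 2 (real n)) ^ 4) \<longrightarrow>
          (\<exists>\<delta>>0. \<forall>\<^sub>F n in at_top.
              measure_pmf.prob (rbg (m n) n (C2 * p2 n))
                {E. bip_connect_prop (m n) n E d (d + 1) (2 ^ (10 * d) * c0 * log 2 (real n))}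
              \<ge> 1 - real n powr (- \<delta>))))"
proof (intro conjI impI)
  define N0 where "N0 = 2 ^ (10 * d) * c0"
  have "(2::real) ^ 4 \<le> 2 ^ (10 * d)" using assms(1) by (intro power_increasing) auto
  then have "2 ^ 4 * 1 \<le> N0" unfolding N0_def using assms(2) by (intro mult_mono) auto
  then have N0: "10 \<le> N0" by simp
  note const = constant_bound[OF assms, folded N0_def]
  {
    assume "odd d"
    then obtain k where "d = Suc (2 * k)" by (auto elim: oddE)
    then obtain r where r: "d = Suc (2 * Suc r)" using assms(1) by (cases k) auto
    show "let C1 = 2 ^ (10 * d) * c0;
           p1 = (\<lambda>n::nat. log 2 (real (m n) * real n) powr (1 / real d) /
                   (real (m n) powr ((real d - 1) / (2 * real d)) *
                    real n powr ((real d - 1) / (2 * real d))))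
       in (\<forall>\<^sub>F n in at_top. p1 n * real n \<ge> p1 n * real (m n) \<and>
                            p1 n * real (m n) \<ge> (log 2 (real n)) ^ 4) \<longrightarrow>
          (\<exists>\<delta>>0. \<forall>\<^sub>F n in at_top.
              measure_pmf.prob (rbg (m n) n (C1 * p1 n))
                {E. bip_connect_prop (m n) n E (d + 1) d (2 ^ (10 * d) * c0 * log 2 (real n))}
              \<ge> 1 - real n powr (- \<delta>))"
      unfolding Let_def N0_def[symmetric]
    proof (intro impI)
      let ?p = "\<lambda>n::nat. log 2 (real (m n) * real n) powr (1 / real d) /
                   (real (m n) powr ((real d - 1) / (2 * real d)) *
                    real n powr ((real d - 1) / (2 * real d)))"
      assume H: "\<forall>\<^sub>F n in at_top. ?p n * real n \<ge> ?p n * real (m n) \<and>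
                            ?p n * real (m n) \<ge> (log 2 (real n)) ^ 4"
      show "\<exists>\<delta>>0. \<forall>\<^sub>F n in at_top. measure_pmf.prob (rbg (m n) n (N0 * ?p n))
                {E. bip_connect_prop (m n) n E (d + 1) d (N0 * log 2 (real n))}
              \<ge> 1 - real n powr (- \<delta>)"
      proof (rule connect_eventually_of_bounds[where C = N0])
        show "\<forall>\<^sub>F n in at_top. 1 \<le> m n \<and> m n \<le> n \<and> (log 2 n) ^ 4 \<le> N0 * ?p n * m n"
          using H eventually_ge_at_top[of 2]
        proof eventually_elim
          case (elim n)
          then show ?case
            using part_sizes[of "?p n" "real (m n)" 1 n "m n" N0] N0 by simp
        qed
        show "8 * (32 * (real d + 1)) ^ (d - 1) * N0 \<le> N0 ^ d" by (rule const) simp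
        fix n assume n: "1 \<le> m n" "m n \<le> n" "2 \<le> n"
        let ?P = "N0 * ?p n"
        show "0 < ?P \<and>
            N0 ^ d * log 2 n \<le> ?P * alt_prod (?P * m n) (?P * n) (d - 1) \<and>
            N0 ^ d * log 2 n \<le> ?P * alt_prod (?P * n) (?P * m n) (d - 1) \<and>
            ?P * alt_prod (?P * m n) (?P * n) (d - 2) \<le>
              2 * N0 ^ d * log 2 n / (?P * m n) \<and>
            ?P * alt_prod (?P * n) (?P * m n) (d - 2) \<le>
              2 * N0 ^ d * log 2 n / (?P * m n)"
          by (intro conjI odd_case_bounds[OF r, of N0 "real (m n)" "real n"]) (use n N0 in auto)
      qed (use assms(1) \<open>odd d\<close> N0 in auto)
    qed
  }
  {
    assume "even d \<and> 0 < \<epsilon> \<and> \<epsilon> < 1"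
    then have "even d" and \<epsilon>: "0 < \<epsilon>" "\<epsilon> < 1" by auto
    from \<open>even d\<close> obtain k where "d = 2 * k" by (auto elim: evenE)
    then obtain r where r: "d = 2 * Suc r" using assms(1) by (cases k) auto
    \<comment> \<open>Dividing by \<epsilon> < 1 enlarges the constant, so \<open>const\<close> also
      applies to \<open>N0 / \<epsilon>\<close>.\<close>
    have C: "N0 \<le> N0 / \<epsilon>" using \<epsilon> N0 by (simp add: field_simps)
    show "let C2 = 2 ^ (10 * d) * c0 / \<epsilon>;
           p2 = (\<lambda>n::nat. log 2 (real n) powr (1 / real d) /
                   (real (m n) powr (1 / 2) *
                    real n powr ((real d - 2) / (2 * real d))))
       in (\<forall>\<^sub>F n in at_top. p2 n * real n powr (1 - \<epsilon>) \<ge> p2 n * real (m n) powr (1 - \<epsilon>) \<and>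
                            p2 n * real (m n) powr (1 - \<epsilon>) \<ge> (log 2 (real n)) ^ 4) \<longrightarrow>
          (\<exists>\<delta>>0. \<forall>\<^sub>F n in at_top.
              measure_pmf.prob (rbg (m n) n (C2 * p2 n))
                {E. bip_connect_prop (m n) n E d (d + 1) (2 ^ (10 * d) * c0 * log 2 (real n))}
              \<ge> 1 - real n powr (- \<delta>))"
      unfolding Let_def N0_def[symmetric]
    proof (intro impI)
      let ?p = "\<lambda>n::nat. log 2 (real n) powr (1 / real d) /
                   (real (m n) powr (1 / 2) *
                    real n powr ((real d - 2) / (2 * real d)))"
      assume H: "\<forall>\<^sub>F n in at_top. ?p n * real n powr (1 - \<epsilon>) \<ge> ?p n * real (m n) powr (1 - \<epsilon>) \<and>
                            ?p n * real (m n) powr (1 - \<epsilon>) \<ge> (log 2 (real n)) ^ 4"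
      show "\<exists>\<delta>>0. \<forall>\<^sub>F n in at_top. measure_pmf.prob (rbg (m n) n (N0 / \<epsilon> * ?p n))
                {E. bip_connect_prop (m n) n E d (d + 1) (N0 * log 2 (real n))}
              \<ge> 1 - real n powr (- \<delta>)"
      proof (rule connect_eventually_of_bounds[where C = "N0 / \<epsilon>"])
        show "\<forall>\<^sub>F n in at_top. 1 \<le> m n \<and> m n \<le> n \<and> (log 2 n) ^ 4 \<le> N0 / \<epsilon> * ?p n * m n"
          using H eventually_ge_at_top[of 2]
        proof eventually_elim
          case (elim n)
          show ?case
            by (rule part_sizes[of "?p n" "real (m n)" "1 - \<epsilon>" n "m n" "N0 / \<epsilon>"])
              (use elim N0 C \<epsilon> in auto)
        qed
        show "8 * (32 * (real d + 1)) ^ (d - 1) * N0 \<le> (N0 / \<epsilon>) ^ d" using C by (rule const)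
        fix n assume n: "1 \<le> m n" "m n \<le> n" "2 \<le> n"
        let ?P = "N0 / \<epsilon> * ?p n"
        show "0 < ?P \<and>
            (N0 / \<epsilon>) ^ d * log 2 n \<le> ?P * alt_prod (?P * m n) (?P * n) (d - 1) \<and>
            (N0 / \<epsilon>) ^ d * log 2 n \<le> ?P * alt_prod (?P * n) (?P * m n) (d - 1) \<and>
            ?P * alt_prod (?P * m n) (?P * n) (d - 2) \<le> 2 * (N0 / \<epsilon>) ^ d * log 2 n / (?P * m n) \<and>
            ?P * alt_prod (?P * n) (?P * m n) (d - 2) \<le> 2 * (N0 / \<epsilon>) ^ d * log 2 n / (?P * m n)"
          by (intro conjI even_case_bounds[OF r, of "N0 / \<epsilon>" "real (m n)" "real n"]) (use n N0 C in auto)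
      qed (use assms(1) \<open>even d\<close> N0 C in auto)
    qed
  }
qed

end
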